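(* Let $\hat\theta^{\mathcal T}\in\arg\min_{\theta\in\Theta}\min_{M\in\mathcal M}\widehat{\mathcal R}^{\mathcal T}_{\theta,M}$ be obtained using only the target data set $\mathcal D^{\mathcal T}$ of $N^{\mathcal T}$ i.i.d. samples from $p^{\mathcal T}(c,x)$. For every $\delta\in(0,1)$, with probability at least $1-\delta$ over the draw of $\mathcal D^{\mathcal T}$, $$\mathcal R^{\mathcal T}_{\hat\theta^{\mathcal T},\widehat M^{\mathcal T}_{\hat\theta^{\mathcal T}}}-\mathcal R^{\mathcal T}_{\hat\theta^{\mathcal T}}\le\frac{2(\mathfrak R^{\mathcal T}_{\Theta,\mathcal M}+\mathfrak R^{\mathcal T}_{\mathcal M})}{\sqrt{N^{\mathcal T}}}+\sqrt{\frac{2}{N^{\mathcal T}}\log\frac2\delta},$$ where moreover $\mathfrak R^{\mathcal T}_{\mathcal M}\le\tfrac12\sqrt{\sup_{\theta\in\Theta}2^{I^{\mathcal T}_2(X;R_\theta)}}$.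
   Context: $\mathcal X$ finite, labels $c\in\{0,1\}$, $\Theta$ arbitrary, $\rho_\theta(x)$ density matrices on $\mathbb C^n$, $\mathcal M$ the binary POVMs $M=(M_0,M_1)$, $M_c\succeq0$, $M_0+M_1=I$; loss $\ell_{\theta,M}(c,x)=1-\mathrm{Tr}(M_c\rho_\theta(x))$. For task $\mathcal A\in\{\mathcal S,\mathcal T\}$ with distribution $p^{\mathcal A}(c,x)$ and data set $\mathcal D^{\mathcal A}$ of $N^{\mathcal A}$ i.i.d. samples: expected risk $\mathcal R^{\mathcal A}_{\theta,M}=\mathbb E_{p^{\mathcal A}}[\ell_{\theta,M}]$, $\mathcal R^{\mathcal A}_\theta=\min_M\mathcal R^{\mathcal A}_{\theta,M}$, empirical risk $\widehat{\mathcal R}^{\mathcal A}_{\theta,M}=\frac1{N^{\mathcal A}}\sum_{(c,x)\in\mathcal D^{\mathcal A}}\ell_{\theta,M}(c,x)$, and $\widehat M^{\mathcal A}_\theta\in\arg\min_{M\in\mathcal M}\widehat{\mathcal R}^{\mathcal A}_{\theta,M}$ (minimizers assumed to exist). Rademacher complexities (with $(c_j,x_j)$ i.i.d. from $p^{\mathcal A}$ and independent uniform signs $\sigma_j\in\{\pm1\}$): $\mathfrak R^{\mathcal A}_{\mathcal M}=\sup_{\theta}\mathbb E[\sup_{M}\sum_{j=1}^{N^{\mathcal A}}\sigma_j\ell_{\theta,M}(c_j,x_j)/\sqrt{N^{\mathcal A}}]$ and $\mathfrak R^{\mathcal A}_{\Theta,\mathcal M}=\mathbb E[\sup_{\theta,M}\sum_{j=1}^{N^{\mathcal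 A}}\sigma_j\ell_{\theta,M}(c_j,x_j)/\sqrt{N^{\mathcal A}}]$. The 2-Rényi mutual information is $I^{\mathcal A}_2(X;R_\theta)=2\log_2\mathrm{Tr}\bigl(\sqrt{\sum_x p^{\mathcal A}(x)\rho_\theta(x)^2}\bigr)$, where $p^{\mathcal A}(x)$ is the input marginal. *)

theory Defs
  imports "HOL-Analysis.Analysis" "HOL-Probability.Probability"
begin

text \<open>Complex n x n matrices are represented as complex^'n^'n (dimension n = CARD('n)).
  Labels c in {0,1} are represented by bool (False = 0, True = 1).\<close>

definition cadj :: "complex^'n^'n \<Rightarrow> complex^'n^'n" where
  "cadj A = (\<chi> i j. cnj (A $ j $ i))"

definition hermitian :: "complex^'n^'n \<Rightarrow> bool" where
  "hermitian A \<longleftrightarrow> cadj A = A"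

definition psd :: "complex^'n^'n \<Rightarrow> bool" where
  "psd A \<longleftrightarrow> hermitian A \<and> (\<forall>v :: complex^'n. 0 \<le> Re (\<Sum>i\<in>UNIV. cnj (v $ i) * (A *v v) $ i))"

definition ctrace :: "complex^'n^'n \<Rightarrow> complex" where
  "ctrace A = (\<Sum>i\<in>UNIV. A $ i $ i)"

definition density_matrix :: "complex^'n^'n \<Rightarrow> bool" where
  "density_matrix A \<longleftrightarrow> psd A \<and> ctrace A = 1"

definition povm :: "(bool \<Rightarrow> complex^'n^'n) \<Rightarrow> bool" where
  "povm M \<longleftrightarrow> psd (M False) \<and> psd (M True) \<and> M False + M True = mat 1"

definition msqrt :: "complex^'n^'n \<Rightarrow> complex^'n^'n" where
  "msqrt A = (THE B. psd B \<and> B ** B = A)"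

text \<open>Loss: 1 - Tr(M_c rho_theta(x)) (a real number for PSD M_c and density rho).\<close>
definition loss :: "('t \<Rightarrow> 'x \<Rightarrow> complex^'n^'n) \<Rightarrow> 't \<Rightarrow> (bool \<Rightarrow> complex^'n^'n) \<Rightarrow> bool \<times> 'x \<Rightarrow> real" where
  "loss rho \<theta> M cx = 1 - Re (ctrace (M (fst cx) ** rho \<theta> (snd cx)))"

definition exp_risk :: "(bool \<times> 'x) pmf \<Rightarrow> ('t \<Rightarrow> 'x \<Rightarrow> complex^'n^'n) \<Rightarrow> 't \<Rightarrow> (bool \<Rightarrow> complex^'n^'n) \<Rightarrow> real" where
  "exp_risk p rho \<theta> M = measure_pmf.expectation p (loss rho \<theta> M)"

text \<open>R_theta = min over POVMs of the expected risk (the minimum is attained; written as infimum).\<close>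
definition opt_risk :: "(bool \<times> 'x) pmf \<Rightarrow> ('t \<Rightarrow> 'x \<Rightarrow> complex^'n^'n) \<Rightarrow> 't \<Rightarrow> real" where
  "opt_risk p rho \<theta> = (INF M\<in>{M. povm M}. exp_risk p rho \<theta> M)"

text \<open>A data set of N samples is a function D with D j the j-th sample, j < N.\<close>
definition emp_risk :: "nat \<Rightarrow> ('t \<Rightarrow> 'x \<Rightarrow> complex^'n^'n) \<Rightarrow> 't \<Rightarrow> (bool \<Rightarrow> complex^'n^'n) \<Rightarrow> (nat \<Rightarrow> bool \<times> 'x) \<Rightarrow> real" where
  "emp_risk N rho \<theta> M D = (\<Sum>j<N. loss rho \<theta> M (D j)) / real N"

definition sample_pmf :: "nat \<Rightarrow> 'a pmf \<Rightarrow> (nat \<Rightarrow> 'a) pmf" where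
  "sample_pmf N p = Pi_pmf {..<N} undefined (\<lambda>_. p)"

definition rademacher :: "real pmf" where
  "rademacher = pmf_of_set {-1, 1}"

definition rad_M :: "nat \<Rightarrow> (bool \<times> 'x) pmf \<Rightarrow> ('t \<Rightarrow> 'x \<Rightarrow> complex^'n^'n) \<Rightarrow> real" where
  "rad_M N p rho = (SUP \<theta>. measure_pmf.expectation (sample_pmf N (pair_pmf p rademacher))
      (\<lambda>S. SUP M\<in>{M. povm M}. (\<Sum>j<N. snd (S j) * loss rho \<theta> M (fst (S j))) / sqrt (real N)))"

definition rad_TM :: "nat \<Rightarrow> (bool \<times> 'x) pmf \<Rightarrow> ('t \<Rightarrow> 'x \<Rightarrow> complex^'n^'n) \<Rightarrow> real" where
  "rad_TM N p rho = measure_pmf.expectation (sample_pmf N (pair_pmf p rademacher))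
      (\<lambda>S. SUP \<theta>M\<in>UNIV \<times> {M. povm M}.
         (\<Sum>j<N. snd (S j) * loss rho (fst \<theta>M) (snd \<theta>M) (fst (S j))) / sqrt (real N))"

definition renyi2_MI :: "(bool \<times> 'x::finite) pmf \<Rightarrow> ('t \<Rightarrow> 'x \<Rightarrow> complex^'n^'n) \<Rightarrow> 't \<Rightarrow> real" where
  "renyi2_MI p rho \<theta> = 2 * log 2 (Re (ctrace (msqrt
      (\<Sum>x\<in>UNIV. pmf (map_pmf snd p) x *\<^sub>R (rho \<theta> x ** rho \<theta> x)))))"

end

theory Submission
  imports Defs
begin

text \<open>
  The empirical minimizer is treated for all parameters at once: its risk is at most \<open>G D + H D\<close>,
  where \<open>G\<close> is the supremum over \<open>(\<theta>, M)\<close> of expected minus empirical risk and \<open>H\<close> is the minimal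
  empirical risk, and \<open>E H\<close> is below every expected risk. Changing one sample changes \<open>G + H\<close> by
  at most \<open>2 / N\<close>, so a single application of McDiarmid's inequality gives the deviation term, and
  symmetrization bounds \<open>E G\<close> by \<open>rad_TM\<close>; the term \<open>rad_M\<close> only enters through its nonnegativity.

  For the Renyi bound, the loss is \<open>1/2 \<mp> Tr (K \<rho>) / 2\<close> with the contraction \<open>K = M\<^sub>1 - M\<^sub>0\<close>.
  Let \<open>Q\<close> be the randomly signed sum of the sampled states divided by \<open>\<surd>N\<close>, and \<open>e\<close> run through an
  orthonormal eigenbasis of \<open>A = E Q\<^sup>2 = \<Sum>\<^sub>x p(x) \<rho>(x)\<^sup>2\<close>. Then \<open>E sup\<^sub>K Tr (K Q) \<le> \<Sum>\<^sub>e E |Q e|\<close>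
  and \<open>E |Q e| \<le> \<surd>(E |Q e|\<^sup>2) = \<surd>\<langle>e, A e\<rangle>\<close>, which sums to the trace of the square root of \<open>A\<close>.

  Complex matrices are treated as real-linear operators on the Euclidean space \<open>complex^'n\<close>, whose
  inner product is the real part of the Hermitian one.
\<close>

section \<open>Self-adjoint operators\<close>

definition orthonormal_basis :: "'a::euclidean_space set \<Rightarrow> bool" where
  "orthonormal_basis E \<longleftrightarrow> pairwise orthogonal E \<and> (\<forall>e\<in>E. norm e = 1) \<and> span E = UNIV"

definition selfadjoint :: "('a::euclidean_space \<Rightarrow> 'a) \<Rightarrow> bool" where
  "selfadjoint f \<longleftrightarrow> linear f \<and> (\<forall>x y. f x \<bullet> y = x \<bullet> f y)"

definition psd_operator :: "('a::euclidean_space \<Rightarrow> 'a) \<Rightarrow> bool" where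
  "psd_operator f \<longleftrightarrow> selfadjoint f \<and> (\<forall>v. 0 \<le> v \<bullet> f v)"

definition eigenbasis :: "('a::euclidean_space \<Rightarrow> 'a) \<Rightarrow> 'a set \<Rightarrow> ('a \<Rightarrow> real) \<Rightarrow> bool" where
  "eigenbasis f E l \<longleftrightarrow> orthonormal_basis E \<and> (\<forall>e\<in>E. f e = l e *\<^sub>R e)"

definition diagonal_operator :: "'a::euclidean_space set \<Rightarrow> ('a \<Rightarrow> real) \<Rightarrow> 'a \<Rightarrow> 'a" where
  "diagonal_operator E l v = (\<Sum>e\<in>E. (l e * (v \<bullet> e)) *\<^sub>R e)"

definition operator_trace :: "('a::euclidean_space \<Rightarrow> 'a) \<Rightarrow> real" where
  "operator_trace f = (\<Sum>b\<in>Basis. b \<bullet> f b)"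

lemma orthonormal_basis_finite: "orthonormal_basis E \<Longrightarrow> finite E"
  by (simp add: orthonormal_basis_def pairwise_orthogonal_imp_finite)

lemma orthonormal_basis_norm: "orthonormal_basis E \<Longrightarrow> e \<in> E \<Longrightarrow> norm e = 1"
  by (simp add: orthonormal_basis_def)

lemma orthonormal_basis_inner:
  assumes "orthonormal_basis E" "e \<in> E" "e' \<in> E"
  shows "e \<bullet> e' = (if e = e' then 1 else 0)"
  using assms by (auto simp: orthonormal_basis_def orthogonal_def dot_square_norm pairwise_def)

lemma orthonormal_basis_expansion: "orthonormal_basis E \<Longrightarrow> (\<Sum>e\<in>E. (v \<bullet> e) *\<^sub>R e) = v"
  using orthonormal_basis_expand[of E v] orthonormal_basis_finite[of E]
  by (simp add: orthonormal_basis_def)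

lemma orthonormal_basis_card:
  fixes E :: "'a::euclidean_space set"
  assumes "orthonormal_basis E"
  shows "card E = DIM('a)"
proof -
  have "0 \<notin> E" using assms by (force simp: orthonormal_basis_def)
  then have "independent E"
    using assms by (simp add: orthonormal_basis_def pairwise_orthogonal_independent)
  then show ?thesis
    using assms dim_span_eq_card_independent[of E] by (simp add: orthonormal_basis_def dim_UNIV)
qed

lemma linear_eq_on_orthonormal_basis:
  assumes "orthonormal_basis E" "linear f" "linear g" "\<And>e. e \<in> E \<Longrightarrow> f e = g e"
  shows "f v = g v"
  using assms linear_eq_on_span[of f g E v] by (simp add: orthonormal_basis_def)

lemma operator_trace_orthonormal_basis:
  fixes f :: "'a::euclidean_space \<Rightarrow> 'a"
  assumes "orthonormal_basis E" "linear f"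
  shows "operator_trace f = (\<Sum>e\<in>E. e \<bullet> f e)"
proof -
  have "operator_trace f = (\<Sum>b\<in>Basis. (\<Sum>e\<in>E. (b \<bullet> e) *\<^sub>R e) \<bullet> f b)"
    by (simp add: operator_trace_def orthonormal_basis_expansion[OF assms(1)])
  also have "\<dots> = (\<Sum>b\<in>Basis. \<Sum>e\<in>E. (b \<bullet> e) * (e \<bullet> f b))"
    by (simp add: inner_sum_left)
  also have "\<dots> = (\<Sum>e\<in>E. \<Sum>b\<in>Basis. (b \<bullet> e) * (e \<bullet> f b))"
    by (rule sum.swap)
  also have "\<dots> = (\<Sum>e\<in>E. e \<bullet> f (\<Sum>b\<in>Basis. (e \<bullet> b) *\<^sub>R b))"
    using assms(2) by (simp add: linear_sum linear_scale inner_sum_right inner_commute)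
  finally show ?thesis by (simp add: euclidean_representation)
qed

lemma nonneg_selfadjoint_isotropic_imp_kernel:
  fixes g :: "'a::euclidean_space \<Rightarrow> 'a"
  assumes selfadjoint_g: "selfadjoint g" and W_invariant: "subspace W" "\<And>w. w \<in> W \<Longrightarrow> g w \<in> W"
    and nonneg: "\<And>w. w \<in> W \<Longrightarrow> 0 \<le> w \<bullet> g w" and v_isotropic: "v \<in> W" "v \<bullet> g v = 0"
  shows "g v = 0"
proof (rule ccontr)
  assume "g v \<noteq> 0"
  \<comment> \<open>A small step \<open>t\<close> from \<open>v\<close> in the direction \<open>- g v\<close> would make the form negative.\<close>
  define u where "u = g v"
  define a where "a = u \<bullet> u"
  define b where "b = u \<bullet> g u"
  define t where "t = a / (b + 1)"
  have linear_g: "linear g" and symmetric: "v \<bullet> g u = a"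
    using selfadjoint_g by (auto simp: selfadjoint_def a_def u_def)
  have u_in_W: "u \<in> W" using v_isotropic W_invariant by (simp add: u_def)
  have a_pos: "a > 0" and b_nonneg: "b \<ge> 0"
    using \<open>g v \<noteq> 0\<close> nonneg[OF u_in_W] by (simp_all add: a_def b_def u_def)
  have "0 \<le> (v - t *\<^sub>R u) \<bullet> g (v - t *\<^sub>R u)"
    using u_in_W v_isotropic W_invariant by (intro nonneg) (simp add: subspace_diff subspace_scale)
  also have "g (v - t *\<^sub>R u) = u - t *\<^sub>R g u"
    by (simp add: linear_diff[OF linear_g] linear_scale[OF linear_g] u_def)
  also have "(v - t *\<^sub>R u) \<bullet> (u - t *\<^sub>R g u) = v \<bullet> u - t * (v \<bullet> g u) - t * a + t * (t * b)"
    by (simp add: inner_diff right_diff_distrib a_def b_def)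
  also have "\<dots> = t * (t * b - 2 * a)"
    using v_isotropic(2) by (simp add: symmetric right_diff_distrib flip: u_def)
  finally have "0 \<le> t * (t * b - 2 * a)" .
  moreover have "0 < t" using a_pos b_nonneg by (simp add: t_def)
  ultimately have "2 * a \<le> t * b" by (simp add: zero_le_mult_iff)
  also have "t * b \<le> a" using a_pos b_nonneg by (simp add: t_def field_simps)
  finally show False using a_pos by simp
qed

lemma selfadjoint_rayleigh_maximizer_eigenvector:
  fixes f :: "'a::euclidean_space \<Rightarrow> 'a"
  assumes selfadjoint_f: "selfadjoint f" and W_invariant: "subspace W" "\<And>w. w \<in> W \<Longrightarrow> f w \<in> W"
    and v_unit: "v \<in> W" "norm v = 1" and v_maximal: "\<And>w. w \<in> W \<Longrightarrow> norm w = 1 \<Longrightarrow> w \<bullet> f w \<le> v \<bullet> f v"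
  shows "f v = (v \<bullet> f v) *\<^sub>R v"
proof -
  define g where "g w = (v \<bullet> f v) *\<^sub>R w - f w" for w
  have linear_f: "linear f" using selfadjoint_f by (simp add: selfadjoint_def)
  have "selfadjoint g"
    using selfadjoint_f unfolding selfadjoint_def g_def
    by (simp add: inner_diff linear_compose_sub linear_compose_scale_right linear_ident)
  moreover have "g w \<in> W" if "w \<in> W" for w
    using that W_invariant by (simp add: g_def subspace_diff subspace_scale)
  moreover have "0 \<le> w \<bullet> g w" if "w \<in> W" for w
  proof (cases "w = 0")
    case False
    then have "(w \<bullet> f w) / (norm w)\<^sup>2 \<le> v \<bullet> f v"
      using v_maximal[of "w /\<^sub>R norm w"] that W_invariant
      by (simp add: subspace_scale linear_scale[OF linear_f] power2_eq_square field_simps)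
    then show ?thesis
      using False by (simp add: g_def inner_diff_right divide_le_eq dot_square_norm)
  qed simp
  moreover have "v \<bullet> g v = 0"
    using v_unit by (simp add: g_def inner_diff_right dot_square_norm)
  ultimately have "g v = 0"
    using nonneg_selfadjoint_isotropic_imp_kernel W_invariant(1) v_unit(1) by blast
  then show ?thesis by (simp add: g_def)
qed

lemma selfadjoint_eigenvector_exists:
  fixes f :: "'a::euclidean_space \<Rightarrow> 'a"
  assumes selfadjoint_f: "selfadjoint f"
    and W_invariant: "subspace W" "W \<noteq> {0}" "\<And>w. w \<in> W \<Longrightarrow> f w \<in> W"
  obtains v c where "v \<in> W" "norm v = 1" "f v = c *\<^sub>R v"
proof -
  let ?K = "W \<inter> sphere 0 1"
  have "compact ?K"
    using W_invariant by (intro closed_Int_compact closed_subspace) auto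
  moreover have "?K \<noteq> {}"
  proof -
    obtain w where "w \<in> W" "w \<noteq> 0" using W_invariant subspace_0 by blast
    then have "w /\<^sub>R norm w \<in> ?K" using W_invariant by (auto simp: subspace_scale)
    then show ?thesis by blast
  qed
  moreover have "continuous_on ?K (\<lambda>w. w \<bullet> f w)"
    using selfadjoint_f by (intro continuous_intros linear_continuous_on)
      (simp add: selfadjoint_def linear_conv_bounded_linear)
  ultimately obtain v where v_in_K: "v \<in> ?K" and "\<And>w. w \<in> ?K \<Longrightarrow> w \<bullet> f w \<le> v \<bullet> f v"
    using continuous_attains_sup[of ?K "\<lambda>w. w \<bullet> f w"] by blast
  then have "f v = (v \<bullet> f v) *\<^sub>R v"
    using selfadjoint_rayleigh_maximizer_eigenvector[OF selfadjoint_f W_invariant(1,3), of v]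
    by simp
  with v_in_K show ?thesis using that by auto
qed

lemma span_insert_orthogonal_complement:
  fixes v :: "'a::euclidean_space"
  assumes subspace_W: "subspace W" and v_unit: "v \<in> W" "norm v = 1"
    and span_E: "span E = {w \<in> W. orthogonal v w}"
  shows "span (insert v E) = W"
proof (rule span_subspace[OF _ _ subspace_W])
  show "insert v E \<subseteq> W" using v_unit(1) span_superset[of E] span_E by auto
  show "W \<subseteq> span (insert v E)"
  proof
    fix w assume "w \<in> W"
    then have "w - (v \<bullet> w) *\<^sub>R v \<in> span E"
      using v_unit subspace_W
      by (simp add: span_E subspace_diff subspace_scale orthogonal_def inner_diff_right
          dot_square_norm)
    then show "w \<in> span (insert v E)" by (subst span_insert) blast
  qed
qed

lemma selfadjoint_eigenvector_orthogonal:
  assumes "selfadjoint f" "f v = c *\<^sub>R v" "orthogonal v w"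
  shows "orthogonal v (f w)"
proof -
  have "v \<bullet> f w = f v \<bullet> w" using assms(1) by (simp add: selfadjoint_def)
  then show ?thesis using assms(2,3) by (simp add: orthogonal_def)
qed

lemma selfadjoint_invariant_subspace_eigenvectors:
  fixes f :: "'a::euclidean_space \<Rightarrow> 'a"
  assumes selfadjoint_f: "selfadjoint f" and "subspace W" "\<And>w. w \<in> W \<Longrightarrow> f w \<in> W"
  shows "\<exists>E. pairwise orthogonal E \<and> (\<forall>e\<in>E. norm e = 1 \<and> (\<exists>c. f e = c *\<^sub>R e)) \<and> span E = W"
  using assms(2,3)
proof (induction "dim W" arbitrary: W rule: less_induct)
  case less
  show ?case
  proof (cases "W = {0}")
    case True
    then show ?thesis by (intro exI[of _ "{}"]) simp
  next
    case False
    then obtain v c where v_eigenvector: "v \<in> W" "norm v = 1" "f v = c *\<^sub>R v"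
      using selfadjoint_eigenvector_exists[OF selfadjoint_f less.prems(1) _ less.prems(2)] by blast
    define V where "V = {w \<in> W. orthogonal v w}"
    have subspace_V: "subspace V"
      using less.prems(1) by (auto simp: V_def subspace_def orthogonal_clauses)
    have V_invariant: "f w \<in> V" if "w \<in> V" for w
      using that less.prems(2) selfadjoint_eigenvector_orthogonal[OF selfadjoint_f v_eigenvector(3)]
      by (simp add: V_def)
    have "v \<notin> V" using v_eigenvector(2) by (auto simp: V_def orthogonal_def dot_square_norm)
    then have "V \<subset> W" using v_eigenvector(1) by (auto simp: V_def)
    then have "dim V < dim W"
      using subspace_V less.prems(1) by (intro dim_psubset) (simp only: span_eq_iff[THEN iffD2])
    with less.hyps[OF _ subspace_V V_invariant] obtain E where
      E_eigenvectors: "pairwise orthogonal E"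
      "\<forall>e\<in>E. norm e = 1 \<and> (\<exists>c. f e = c *\<^sub>R e)" "span E = V"
      by blast
    have "span (insert v E) = W"
      using less.prems(1) v_eigenvector(1,2) E_eigenvectors(3) unfolding V_def
      by (rule span_insert_orthogonal_complement)
    moreover have "orthogonal v e" if "e \<in> E" for e
      using span_base[OF that] E_eigenvectors(3) by (simp add: V_def)
    ultimately show ?thesis
      using E_eigenvectors v_eigenvector
      by (intro exI[of _ "insert v E"]) (auto simp: pairwise_insert orthogonal_commute)
  qed
qed

theorem selfadjoint_eigenbasis:
  assumes "selfadjoint f"
  obtains E l where "eigenbasis f E l"
proof -
  obtain E where E_eigenvectors: "pairwise orthogonal E" "\<forall>e\<in>E. norm e = 1 \<and> (\<exists>c. f e = c *\<^sub>R e)"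
    "span E = UNIV"
    using selfadjoint_invariant_subspace_eigenvectors[OF assms subspace_UNIV] by blast
  then obtain l where "\<forall>e\<in>E. f e = l e *\<^sub>R e"
    using bchoice[of E "\<lambda>e c. f e = c *\<^sub>R e"] by blast
  with E_eigenvectors have "eigenbasis f E l" by (simp add: eigenbasis_def orthonormal_basis_def)
  then show ?thesis by (rule that)
qed

lemma eigenbasis_quadratic_form: "eigenbasis f E l \<Longrightarrow> e \<in> E \<Longrightarrow> e \<bullet> f e = l e"
  using orthonormal_basis_inner[of E e e] by (simp add: eigenbasis_def)

lemma psd_operator_eigenbasis:
  assumes psd_f: "psd_operator f"
  obtains E l where "eigenbasis f E l" "\<And>e. e \<in> E \<Longrightarrow> 0 \<le> l e"
proof -
  have "selfadjoint f" using psd_f by (simp add: psd_operator_def)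
  then obtain E l where eigenbasis: "eigenbasis f E l" by (rule selfadjoint_eigenbasis)
  have "0 \<le> l e" if "e \<in> E" for e
    using psd_f by (simp add: psd_operator_def flip: eigenbasis_quadratic_form[OF eigenbasis that])
  with eigenbasis show ?thesis by (rule that)
qed

lemma linear_diagonal_operator: "linear (diagonal_operator E l)"
  by (rule linearI)
    (simp_all add: diagonal_operator_def inner_add_left distrib_left scaleR_left_distrib sum.distrib
      scaleR_sum_right mult.left_commute)

lemma psd_diagonal_operator:
  assumes "\<And>e. e \<in> E \<Longrightarrow> 0 \<le> l e"
  shows "psd_operator (diagonal_operator E l)"
  unfolding psd_operator_def selfadjoint_def
proof (intro conjI allI linear_diagonal_operator)
  show "diagonal_operator E l x \<bullet> y = x \<bullet> diagonal_operator E l y" for x y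
    unfolding diagonal_operator_def inner_sum_left inner_sum_right
    by (intro sum.cong) (simp_all add: inner_commute)
  show "0 \<le> v \<bullet> diagonal_operator E l v" for v
    unfolding diagonal_operator_def inner_sum_right
    by (intro sum_nonneg) (simp add: assms mult.assoc)
qed

lemma diagonal_operator_basis:
  assumes "orthonormal_basis E" "e \<in> E"
  shows "diagonal_operator E l e = l e *\<^sub>R e"
proof -
  have "diagonal_operator E l e = (\<Sum>e'\<in>E. if e' = e then l e *\<^sub>R e else 0)"
    unfolding diagonal_operator_def
    by (intro sum.cong) (simp_all add: orthonormal_basis_inner[OF assms])
  also have "\<dots> = l e *\<^sub>R e"
    by (simp add: orthonormal_basis_finite[OF assms(1)] assms(2))
  finally show ?thesis .
qed

lemma eigenbasis_imp_diagonal_operator: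
  assumes "linear f" "eigenbasis f E l"
  shows "f v = diagonal_operator E l v"
  using assms linear_eq_on_orthonormal_basis[of E f "diagonal_operator E l"]
  by (simp add: eigenbasis_def diagonal_operator_basis linear_diagonal_operator)

lemma norm_psd_operator_le_trace:
  assumes psd_f: "psd_operator f"
  shows "norm (f v) \<le> operator_trace f * norm v"
proof -
  have linear_f: "linear f" using psd_f by (simp add: psd_operator_def selfadjoint_def)
  obtain E l where eigenbasis: "eigenbasis f E l" and eigenvalue_nonneg: "\<And>e. e \<in> E \<Longrightarrow> 0 \<le> l e"
    using psd_operator_eigenbasis[OF psd_f] by blast
  then have orthonormal: "orthonormal_basis E" by (simp add: eigenbasis_def)
  have "norm (f v) \<le> (\<Sum>e\<in>E. l e * norm v)"
    unfolding eigenbasis_imp_diagonal_operator[OF linear_f eigenbasis] diagonal_operator_def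
  proof (rule sum_norm_le)
    fix e assume e_in_E: "e \<in> E"
    then show "norm ((l e * (v \<bullet> e)) *\<^sub>R e) \<le> l e * norm v"
      using Cauchy_Schwarz_ineq2[of v e] eigenvalue_nonneg[OF e_in_E]
        orthonormal_basis_norm[OF orthonormal e_in_E]
      by (simp add: abs_mult mult_left_mono)
  qed
  also have "\<dots> = operator_trace f * norm v"
    using eigenbasis_quadratic_form[OF eigenbasis]
    by (simp add: operator_trace_orthonormal_basis[OF orthonormal linear_f] sum_distrib_right)
  finally show ?thesis .
qed

lemma psd_operator_root_eigenvector:
  assumes psd_g: "psd_operator g" and e_root: "g (g e) = l *\<^sub>R e" and l_nonneg: "l \<ge> 0"
  shows "g e = sqrt l *\<^sub>R e"
proof -
  have linear_g: "linear g" and symmetric: "\<And>x y. g x \<bullet> y = x \<bullet> g y" and nonneg: "\<And>v. 0 \<le> v \<bullet> g v"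
    using psd_g by (auto simp: psd_operator_def selfadjoint_def)
  define w where "w = g e - sqrt l *\<^sub>R e"
  have g_w: "g w = - sqrt l *\<^sub>R w"
    using l_nonneg
    by (simp add: w_def linear_diff[OF linear_g] linear_scale[OF linear_g] e_root scaleR_diff_right)
  have "w = 0"
  proof (cases "l = 0")
    case True
    have "g e \<bullet> g e = e \<bullet> g (g e)" by (rule symmetric)
    then show ?thesis using True e_root by (simp add: w_def)
  next
    case False
    then have "0 < sqrt l" using l_nonneg by simp
    moreover have "0 \<le> - sqrt l * (w \<bullet> w)" using nonneg[of w] by (simp add: g_w)
    ultimately have "w \<bullet> w \<le> 0" by (simp add: mult_le_0_iff)
    then show ?thesis by (metis inner_gt_zero_iff not_le)
  qed
  then show ?thesis by (simp add: w_def)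
qed

lemma psd_operator_root_exists:
  assumes psd_f: "psd_operator f"
  obtains g where "psd_operator g" "\<And>v. g (g v) = f v"
proof -
  obtain E l where eigenbasis: "eigenbasis f E l" and eigenvalue_nonneg: "\<And>e. e \<in> E \<Longrightarrow> 0 \<le> l e"
    using psd_operator_eigenbasis[OF psd_f] by blast
  let ?g = "diagonal_operator E (\<lambda>e. sqrt (l e))"
  have psd_root: "psd_operator ?g" using eigenvalue_nonneg by (intro psd_diagonal_operator) simp
  have "?g (?g v) = f v" for v
  proof (rule linear_eq_on_orthonormal_basis[of E "\<lambda>v. ?g (?g v)"])
    show "linear (\<lambda>v. ?g (?g v))"
      using linear_compose[OF linear_diagonal_operator linear_diagonal_operator]
      by (simp add: o_def)
    show "linear f" using psd_f by (simp add: psd_operator_def selfadjoint_def)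
    show "orthonormal_basis E" using eigenbasis by (simp add: eigenbasis_def)
    show "?g (?g e) = f e" if "e \<in> E" for e
      using eigenbasis that eigenvalue_nonneg
      by (simp add: eigenbasis_def diagonal_operator_basis
          linear_scale[OF linear_diagonal_operator])
  qed
  with psd_root show ?thesis by (rule that)
qed

lemma psd_operator_root_commutes:
  assumes psd_g: "psd_operator g" and J_commuting: "linear J" "\<And>v. J (g (g v)) = g (g (J v))"
  shows "g (J v) = J (g v)"
proof -
  have linear_g: "linear g" using psd_g by (simp add: psd_operator_def selfadjoint_def)
  obtain E m where eigenbasis: "eigenbasis g E m" and eigenvalue_nonneg: "\<And>e. e \<in> E \<Longrightarrow> 0 \<le> m e"
    using psd_operator_eigenbasis[OF psd_g] by blast
  show ?thesis
  proof (rule linear_eq_on_orthonormal_basis[of E "\<lambda>v. g (J v)" "\<lambda>v. J (g v)"])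
    show "orthonormal_basis E" using eigenbasis by (simp add: eigenbasis_def)
    show "linear (\<lambda>v. g (J v))" "linear (\<lambda>v. J (g v))"
      using linear_compose[OF J_commuting(1) linear_g] linear_compose[OF linear_g J_commuting(1)]
      by (simp_all add: o_def)
    fix e assume e_in_E: "e \<in> E"
    then have g_eigenvector: "g e = m e *\<^sub>R e" using eigenbasis by (simp add: eigenbasis_def)
    then have "g (g (J e)) = (m e)\<^sup>2 *\<^sub>R J e"
      by (simp add: J_commuting(2)[symmetric] linear_scale[OF linear_g]
          linear_scale[OF J_commuting(1)] power2_eq_square)
    then have "g (J e) = m e *\<^sub>R J e"
      using psd_operator_root_eigenvector[OF psd_g, of "J e" "(m e)\<^sup>2"] eigenvalue_nonneg[OF e_in_E]
      by simp
    then show "g (J e) = J (g e)" by (simp add: g_eigenvector linear_scale[OF J_commuting(1)])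
  qed
qed

section \<open>Complex matrices as real-linear operators\<close>

lemma inner_cadj: "(A *v v) \<bullet> w = v \<bullet> (cadj A *v w)" for A :: "complex^'n^'n"
proof -
  have "(A *v v) \<bullet> w = (\<Sum>i\<in>UNIV. \<Sum>j\<in>UNIV. (A $ i $ j * v $ j) \<bullet> w $ i)"
    by (simp add: inner_vec_def matrix_vector_mult_def inner_sum_left)
  also have "\<dots> = (\<Sum>j\<in>UNIV. \<Sum>i\<in>UNIV. (A $ i $ j * v $ j) \<bullet> w $ i)"
    by (rule sum.swap)
  also have "\<dots> = (\<Sum>j\<in>UNIV. \<Sum>i\<in>UNIV. v $ j \<bullet> (cnj (A $ i $ j) * w $ i))"
    by (intro sum.cong refl) (simp add: inner_complex_def algebra_simps)
  also have "\<dots> = v \<bullet> (cadj A *v w)"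
    by (simp add: inner_vec_def matrix_vector_mult_def inner_sum_right cadj_def)
  finally show ?thesis .
qed

lemma hermitian_iff_selfadjoint: "hermitian A \<longleftrightarrow> selfadjoint ((*v) A)"
proof
  assume "hermitian A"
  then show "selfadjoint ((*v) A)"
    using inner_cadj[of A] by (simp add: selfadjoint_def hermitian_def)
next
  assume "selfadjoint ((*v) A)"
  then have "v \<bullet> (cadj A *v w) = v \<bullet> (A *v w)" for v w
    using inner_cadj[of A v w] by (simp add: selfadjoint_def)
  then have "cadj A *v w = A *v w" for w
    by (metis vector_eq_ldot)
  then show "hermitian A" by (simp add: hermitian_def matrix_eq)
qed

lemma psd_iff_psd_operator: "psd A \<longleftrightarrow> psd_operator ((*v) A)"
proof -
  have "Re (\<Sum>i\<in>UNIV. cnj (v $ i) * (A *v v) $ i) = v \<bullet> (A *v v)" for v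
    by (simp add: inner_vec_def inner_complex_def)
  then show ?thesis by (simp add: psd_def psd_operator_def hermitian_iff_selfadjoint)
qed

lemma psd_eigenbasis:
  fixes A :: "complex^'n^'n"
  assumes "psd A"
  obtains E l where "eigenbasis ((*v) A) E l" "\<And>e. e \<in> E \<Longrightarrow> 0 \<le> l e"
  using assms psd_operator_eigenbasis[of "(*v) A"] by (auto simp: psd_iff_psd_operator)

lemma psd_hermitian_inner: "psd A \<Longrightarrow> (A *v v) \<bullet> w = v \<bullet> (A *v w)"
  by (simp add: psd_iff_psd_operator psd_operator_def selfadjoint_def)

lemma psd_quadratic_form_nonneg: "psd A \<Longrightarrow> 0 \<le> v \<bullet> (A *v v)"
  by (simp add: psd_iff_psd_operator psd_operator_def)

text \<open>The factor 2 is the real dimension of the complex numbers.\<close>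

lemma operator_trace_matrix: "operator_trace ((*v) A) = 2 * Re (ctrace A)" for A :: "complex^'n^'n"
proof -
  have column: "(A *v axis i b) $ i = A $ i $ i * b" for i b
    by (simp add: matrix_vector_mult_def axis_def if_distrib cong: if_cong)
  have inj: "inj_on (\<lambda>(i,b). axis i b :: complex^'n) (UNIV \<times> Basis)"
    by (auto simp: inj_on_def axis_eq_axis nonzero_Basis)
  have basis: "(Basis :: (complex^'n) set) = (\<lambda>(i,b). axis i b) ` (UNIV \<times> Basis)"
    by (auto simp: Basis_vec_def)
  have "operator_trace ((*v) A) = (\<Sum>(i,b)\<in>UNIV \<times> Basis. axis i b \<bullet> (A *v axis i b))"
    unfolding operator_trace_def basis using sum.reindex[OF inj, of "\<lambda>b. b \<bullet> (A *v b)"]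
    by (simp add: o_def case_prod_unfold)
  also have "\<dots> = (\<Sum>i\<in>UNIV. \<Sum>b\<in>Basis. b \<bullet> (A $ i $ i * b))"
    by (simp add: inner_axis' column flip: sum.cartesian_product)
  also have "\<dots> = (\<Sum>i\<in>UNIV. 2 * Re (A $ i $ i))"
    by (simp add: Basis_complex_def inner_complex_def)
  finally show ?thesis by (simp add: ctrace_def sum_distrib_left)
qed

lemma Re_ctrace_orthonormal_basis:
  fixes A :: "complex^'n^'n"
  assumes "orthonormal_basis E"
  shows "Re (ctrace A) = (\<Sum>e\<in>E. e \<bullet> (A *v e)) / 2"
  using operator_trace_matrix[of A] operator_trace_orthonormal_basis[OF assms, of "(*v) A"] by simp

lemma Re_ctrace_mult_orthonormal_basis:
  fixes A B :: "complex^'n^'n"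
  assumes "orthonormal_basis E" "hermitian A"
  shows "Re (ctrace (A ** B)) = (\<Sum>e\<in>E. (A *v e) \<bullet> (B *v e)) / 2"
  using assms(2) inner_cadj[of A]
  by (simp add: Re_ctrace_orthonormal_basis[OF assms(1)] hermitian_def
      flip: matrix_vector_mul_assoc)

lemma Re_ctrace_psd_mult_nonneg:
  fixes A B :: "complex^'n^'n"
  assumes psd_A: "psd A" and psd_B: "psd B"
  shows "0 \<le> Re (ctrace (A ** B))"
proof -
  obtain E l where eigenbasis: "eigenbasis ((*v) B) E l"
    and eigenvalue_nonneg: "\<And>e. e \<in> E \<Longrightarrow> 0 \<le> l e"
    using psd_eigenbasis[OF psd_B] by blast
  have "0 \<le> (A *v e) \<bullet> (B *v e)" if "e \<in> E" for e
    using eigenbasis that eigenvalue_nonneg[OF that] psd_quadratic_form_nonneg[OF psd_A, of e]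
    by (simp add: eigenbasis_def inner_commute)
  then show ?thesis
    using eigenbasis psd_A
    by (simp add: Re_ctrace_mult_orthonormal_basis[of E] eigenbasis_def psd_def sum_nonneg)
qed

lemma complex_linear_matrix_works:
  fixes f :: "complex^'n \<Rightarrow> complex^'m"
  assumes linear_f: "linear f" and i_linear: "\<And>v. f (\<i> *s v) = \<i> *s f v"
  shows "matrix f *v v = f v"
proof -
  have split: "c *s w = Re c *\<^sub>R w + Im c *\<^sub>R (\<i> *s w)" for c and w :: "complex^'k"
    by (simp add: vec_eq_iff complex_eq_iff)
  have "f (c *s w) = c *s f w" for c w
    unfolding split[of c] by (simp add: linear_add[OF linear_f] linear_scale[OF linear_f] i_linear)
  then have "Vector_Spaces.linear (*s) (*s) f"
    by unfold_locales (simp_all add: linear_add[OF linear_f] algebra_simps)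
  then show ?thesis by (rule matrix_works)
qed

lemma psd_root_exists:
  fixes A :: "complex^'n^'n"
  assumes "psd A"
  obtains B where "psd B" "B ** B = A"
proof -
  obtain g where psd_g: "psd_operator g" and g_squared: "\<And>v. g (g v) = A *v v"
    using assms psd_operator_root_exists psd_iff_psd_operator by blast
  \<comment> \<open>The real-linear \<open>g\<close> is a complex matrix because it commutes with \<open>\<i>\<close>.\<close>
  have "linear (\<lambda>v. \<i> *s v :: complex^'n)"
    by (rule linearI) (simp_all add: vec_eq_iff algebra_simps)
  moreover have "\<i> *s (A *v v) = A *v (\<i> *s v)" for v
    by (simp add: vec_eq_iff matrix_vector_mult_def sum_distrib_left algebra_simps)
  ultimately have "g (\<i> *s v) = \<i> *s g v" for v
    by (intro psd_operator_root_commutes[OF psd_g]) (simp_all add: g_squared)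
  moreover have "linear g" using psd_g by (simp add: psd_operator_def selfadjoint_def)
  ultimately have matrix_g: "matrix g *v v = g v" for v
    by (intro complex_linear_matrix_works)
  then have "(*v) (matrix g) = g" by blast
  then have "psd (matrix g)" using psd_g by (simp add: psd_iff_psd_operator)
  moreover have "matrix g ** matrix g = A"
    by (simp add: matrix_eq matrix_g g_squared flip: matrix_vector_mul_assoc)
  ultimately show ?thesis by (rule that)
qed

lemma psd_root_eigenvector:
  fixes A B :: "complex^'n^'n"
  assumes "psd B" "B ** B = A" "A *v e = l *\<^sub>R e" "0 \<le> l"
  shows "B *v e = sqrt l *\<^sub>R e"
  using assms psd_operator_root_eigenvector[of "(*v) B" e l]
  by (simp add: psd_iff_psd_operator matrix_vector_mul_assoc)

lemma psd_root_unique: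
  fixes A B C :: "complex^'n^'n"
  assumes psd_A: "psd A" and B_root: "psd B" "B ** B = A" and C_root: "psd C" "C ** C = A"
  shows "B = C"
proof -
  obtain E l where eigenbasis: "eigenbasis ((*v) A) E l"
    and eigenvalue_nonneg: "\<And>e. e \<in> E \<Longrightarrow> 0 \<le> l e"
    using psd_eigenbasis[OF psd_A] by blast
  have "B *v e = C *v e" if e_in_E: "e \<in> E" for e
  proof -
    have A_eigenvector: "A *v e = l e *\<^sub>R e" using eigenbasis e_in_E by (simp add: eigenbasis_def)
    show ?thesis
      by (simp only: psd_root_eigenvector[OF B_root A_eigenvector eigenvalue_nonneg[OF e_in_E]]
          psd_root_eigenvector[OF C_root A_eigenvector eigenvalue_nonneg[OF e_in_E]])
  qed
  then have "B *v v = C *v v" for v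
    using eigenbasis linear_eq_on_orthonormal_basis[of E "(*v) B" "(*v) C"]
    by (simp add: eigenbasis_def)
  then show ?thesis by (simp add: matrix_eq)
qed

lemma psd_msqrt_msqrt_mult:
  assumes "psd A"
  shows "psd (msqrt A) \<and> msqrt A ** msqrt A = A"
proof -
  obtain B where "psd B" "B ** B = A" using psd_root_exists[OF assms] by blast
  then show ?thesis
    unfolding msqrt_def
    by (intro theI[of "\<lambda>C. psd C \<and> C ** C = A" B]) (auto intro: psd_root_unique[OF assms])
qed

lemma Re_ctrace_msqrt:
  assumes psd_A: "psd A" and eigenbasis: "eigenbasis ((*v) A) E l"
  shows "Re (ctrace (msqrt A)) = (\<Sum>e\<in>E. sqrt (l e)) / 2"
proof -
  have orthonormal: "orthonormal_basis E" using eigenbasis by (simp add: eigenbasis_def)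
  have "e \<bullet> (msqrt A *v e) = sqrt (l e)" if e_in_E: "e \<in> E" for e
  proof -
    have "0 \<le> l e"
      using eigenbasis_quadratic_form[OF eigenbasis e_in_E]
        psd_quadratic_form_nonneg[OF psd_A, of e] by simp
    then have "msqrt A *v e = sqrt (l e) *\<^sub>R e"
      using eigenbasis e_in_E psd_msqrt_msqrt_mult[OF psd_A]
        psd_root_eigenvector[of "msqrt A" A e "l e"]
      by (simp add: eigenbasis_def)
    then show ?thesis using orthonormal_basis_inner[OF orthonormal e_in_E e_in_E] by simp
  qed
  then show ?thesis by (simp add: Re_ctrace_orthonormal_basis[OF orthonormal])
qed

section \<open>Independent samples and McDiarmid's inequality\<close>

lemma pmf_expectation_mono:
  fixes f g :: "'a \<Rightarrow> real"
  assumes "finite (set_pmf p)" "\<And>x. x \<in> set_pmf p \<Longrightarrow> f x \<le> g x"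
  shows "measure_pmf.expectation p f \<le> measure_pmf.expectation p g"
  using assms
  by (intro integral_mono_AE integrable_measure_pmf_finite) (auto simp: AE_measure_pmf_iff)

lemma pmf_expectation_le_sqrt:
  fixes Y :: "'a \<Rightarrow> real"
  assumes "finite (set_pmf p)"
  shows "measure_pmf.expectation p Y \<le> sqrt (measure_pmf.expectation p (\<lambda>a. (Y a)\<^sup>2))"
proof -
  have "0 \<le> measure_pmf.variance p Y" by simp
  also have "\<dots> = measure_pmf.expectation p (\<lambda>a. (Y a)\<^sup>2) - (measure_pmf.expectation p Y)\<^sup>2"
    using assms by (intro measure_pmf.variance_eq integrable_measure_pmf_finite)
  finally show ?thesis by (intro real_le_rsqrt) simp
qed

lemma expectation_pair_pmf:
  fixes f :: "'a \<times> 'b \<Rightarrow> real"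
  assumes "finite (set_pmf p)" "finite (set_pmf q)"
  shows "measure_pmf.expectation (pair_pmf p q) f
    = measure_pmf.expectation p (\<lambda>a. measure_pmf.expectation q (\<lambda>b. f (a, b)))"
proof -
  have "pair_pmf p q = bind_pmf p (\<lambda>a. map_pmf (Pair a) q)"
    by (simp add: pair_pmf_def map_pmf_def)
  then have "measure_pmf.expectation (pair_pmf p q) f
     = (\<Sum>a\<in>set_pmf p. pmf p a *\<^sub>R measure_pmf.expectation (map_pmf (Pair a) q) f)"
    using assms by (simp add: pmf_expectation_bind[where A = "set_pmf p"])
  also have "\<dots> = measure_pmf.expectation p (\<lambda>a. measure_pmf.expectation q (\<lambda>b. f (a, b)))"
    using assms by (simp add: integral_measure_pmf[where A = "set_pmf p"])
  finally show ?thesis .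
qed

lemma expectation_swap:
  fixes f :: "'a \<Rightarrow> 'b \<Rightarrow> real"
  assumes "finite (set_pmf p)" "finite (set_pmf q)"
  shows "measure_pmf.expectation p (\<lambda>a. measure_pmf.expectation q (f a))
    = measure_pmf.expectation q (\<lambda>b. measure_pmf.expectation p (\<lambda>a. f a b))"
  using expectation_pair_pmf[OF assms, of "\<lambda>(a, b). f a b"]
    expectation_pair_pmf[OF assms(2,1), of "\<lambda>(b, a). f a b"]
  by (subst (asm) pair_commute_pmf) (simp add: case_prod_unfold)

lemma finite_set_Pi_pmf:
  assumes "finite A" "\<And>i. finite (set_pmf (p i))"
  shows "finite (set_pmf (Pi_pmf A d p))"
  using assms by (auto simp: set_Pi_pmf intro!: finite_PiE_dflt)

lemma expectation_Pi_pmf_component: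
  fixes h :: "'a \<Rightarrow> 'v::{banach, second_countable_topology}"
  assumes "finite A" "i \<in> A"
  shows "measure_pmf.expectation (Pi_pmf A d p) (\<lambda>D. h (D i)) = measure_pmf.expectation (p i) h"
proof -
  have "measure_pmf.expectation (p i) h
      = measure_pmf.expectation (map_pmf (\<lambda>D. D i) (Pi_pmf A d p)) h"
    using assms by (simp add: Pi_pmf_component)
  then show ?thesis by simp
qed

lemma expectation_Pi_pmf_insert:
  fixes f :: "('i \<Rightarrow> 'a) \<Rightarrow> real"
  assumes finite_A: "finite A" "i \<notin> A" and finite_p: "\<And>i. finite (set_pmf (p i))"
  shows "measure_pmf.expectation (Pi_pmf (insert i A) d p) f
    = measure_pmf.expectation (Pi_pmf A d p)
        (\<lambda>D. measure_pmf.expectation (p i) (\<lambda>a. f (D(i := a))))"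
proof -
  let ?P = "Pi_pmf A d p"
  have finite_P: "finite (set_pmf ?P)" using finite_A(1) finite_p by (rule finite_set_Pi_pmf)
  have "measure_pmf.expectation (Pi_pmf (insert i A) d p) f
    = measure_pmf.expectation (pair_pmf (p i) ?P) (\<lambda>(a, D). f (D(i := a)))"
    using finite_A by (simp add: Pi_pmf_insert case_prod_unfold)
  also have "\<dots> = measure_pmf.expectation (p i) (\<lambda>a. measure_pmf.expectation ?P (\<lambda>D. f (D(i := a))))"
    by (simp add: expectation_pair_pmf[OF finite_p finite_P])
  also have "\<dots> = measure_pmf.expectation ?P (\<lambda>D. measure_pmf.expectation (p i) (\<lambda>a. f (D(i := a))))"
    by (rule expectation_swap[OF finite_p finite_P])
  finally show ?thesis .
qed

lemma Hoeffdings_lemma_pmf: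
  fixes f :: "'a \<Rightarrow> real"
  assumes finite_p: "finite (set_pmf p)" and l_pos: "l > 0"
    and range_le: "\<And>a b. a \<in> set_pmf p \<Longrightarrow> b \<in> set_pmf p \<Longrightarrow> f a - f b \<le> c"
  shows "measure_pmf.expectation p (\<lambda>a. exp (l * (f a - measure_pmf.expectation p f)))
    \<le> exp (l\<^sup>2 * c\<^sup>2 / 8)"
proof -
  define m where "m = Min (f ` set_pmf p)"
  have lower: "m \<le> f a" if "a \<in> set_pmf p" for a using that finite_p by (simp add: m_def)
  have "m \<in> f ` set_pmf p"
    unfolding m_def using finite_p by (intro Min_in) (auto simp: set_pmf_not_empty)
  then have upper: "f a \<le> m + c" if "a \<in> set_pmf p" for a
    using range_le that by (force simp: algebra_simps)
  interpret interval_bounded_random_variable "measure_pmf p" f m "m + c"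
    by unfold_locales (use lower upper in \<open>auto simp: AE_measure_pmf_iff\<close>)
  have "ennreal (measure_pmf.expectation p (\<lambda>a. exp (l * (f a - measure_pmf.expectation p f))))
      = nn_integral p (\<lambda>a. exp (l * (f a - measure_pmf.expectation p f)))"
    using finite_p by (intro nn_integral_eq_integral[symmetric] integrable_measure_pmf_finite) auto
  also have "\<dots> \<le> ennreal (exp (l\<^sup>2 * c\<^sup>2 / 8))"
    using Hoeffdings_lemma_nn_integral[OF l_pos] by simp
  finally show ?thesis by simp
qed

lemma expectation_update_bounded_difference:
  fixes f :: "('i \<Rightarrow> 'a) \<Rightarrow> real"
  assumes finite_q: "finite (set_pmf q)" and "i \<noteq> j" and bounded: "\<And>D. f (D(j := b)) \<le> f D + c"
  shows "measure_pmf.expectation q (\<lambda>a. f (D(j := b, i := a)))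
    \<le> measure_pmf.expectation q (\<lambda>a. f (D(i := a))) + c"
proof -
  have "D(j := b, i := a) = D(i := a, j := b)" for a
    using \<open>i \<noteq> j\<close> by (intro fun_upd_twist) auto
  then have "measure_pmf.expectation q (\<lambda>a. f (D(j := b, i := a)))
      \<le> measure_pmf.expectation q (\<lambda>a. f (D(i := a)) + c)"
    by (simp only:) (intro pmf_expectation_mono finite_q bounded)
  then show ?thesis by (simp add: integrable_measure_pmf_finite finite_q)
qed

lemma bounded_update_mgf:
  fixes f :: "('i \<Rightarrow> 'a) \<Rightarrow> real"
  assumes finite_q: "finite (set_pmf q)" and l_pos: "l > 0"
    and bounded: "\<And>D a. f (D(i := a)) \<le> f D + c"
  shows "measure_pmf.expectation q
      (\<lambda>a. exp (l * (f (D(i := a)) - measure_pmf.expectation q (\<lambda>a. f (D(i := a))))))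
    \<le> exp (l\<^sup>2 * c\<^sup>2 / 8)"
proof (rule Hoeffdings_lemma_pmf[OF finite_q l_pos])
  show "f (D(i := a)) - f (D(i := b)) \<le> c" for a b
    using bounded[of "D(i := b)" a] unfolding fun_upd_upd by linarith
qed

lemma bounded_differences_mgf:
  fixes f :: "('i \<Rightarrow> 'a) \<Rightarrow> real"
  assumes finite_A: "finite A" and finite_p: "\<And>i. finite (set_pmf (p i))" and l_pos: "l > 0"
    and bounded: "\<And>D i a. i \<in> A \<Longrightarrow> f (D(i := a)) \<le> f D + c i"
  shows "measure_pmf.expectation (Pi_pmf A d p)
      (\<lambda>D. exp (l * (f D - measure_pmf.expectation (Pi_pmf A d p) f)))
    \<le> exp (l\<^sup>2 * (\<Sum>i\<in>A. (c i)\<^sup>2) / 8)"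
  using finite_A bounded
proof (induction A arbitrary: f)
  case empty
  then show ?case by simp
next
  case (insert i A)
  let ?E = "measure_pmf.expectation (Pi_pmf A d p)"
  define g where "g D = measure_pmf.expectation (p i) (\<lambda>a. f (D(i := a)))" for D
  note expectation_insert = expectation_Pi_pmf_insert[OF insert.hyps(1,2) finite_p]
  have expectation_f: "measure_pmf.expectation (Pi_pmf (insert i A) d p) f = ?E g"
    by (simp add: expectation_insert g_def[abs_def])
  have g_bounded: "g (D(j := b)) \<le> g D + c j" if "j \<in> A" for D j b
    unfolding g_def using that insert.hyps(2) insert.prems
    by (intro expectation_update_bounded_difference finite_p) auto
  have conditional_mgf: "measure_pmf.expectation (p i) (\<lambda>a. exp (l * (f (D(i := a)) - g D)))
      \<le> exp (l\<^sup>2 * (c i)\<^sup>2 / 8)" for D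
    unfolding g_def using finite_p l_pos insert.prems[OF insertI1] by (rule bounded_update_mgf)
  have "measure_pmf.expectation (Pi_pmf (insert i A) d p) (\<lambda>D. exp (l * (f D - ?E g)))
    = ?E (\<lambda>D. exp (l * (g D - ?E g))
        * measure_pmf.expectation (p i) (\<lambda>a. exp (l * (f (D(i := a)) - g D))))"
    by (simp add: expectation_insert algebra_simps flip: exp_add integral_mult_right_zero)
  also have "\<dots> \<le> ?E (\<lambda>D. exp (l * (g D - ?E g)) * exp (l\<^sup>2 * (c i)\<^sup>2 / 8))"
    by (intro pmf_expectation_mono finite_set_Pi_pmf insert.hyps finite_p mult_left_mono
        conditional_mgf) simp
  also have "\<dots> = ?E (\<lambda>D. exp (l * (g D - ?E g))) * exp (l\<^sup>2 * (c i)\<^sup>2 / 8)"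
    by simp
  also have "\<dots> \<le> exp (l\<^sup>2 * (\<Sum>i\<in>A. (c i)\<^sup>2) / 8) * exp (l\<^sup>2 * (c i)\<^sup>2 / 8)"
    by (intro mult_right_mono insert.IH g_bounded) auto
  also have "\<dots> = exp (l\<^sup>2 * (\<Sum>i\<in>insert i A. (c i)\<^sup>2) / 8)"
    using insert.hyps by (simp add: distrib_left add_divide_distrib add.commute flip: exp_add)
  finally show ?case unfolding expectation_f .
qed

theorem McDiarmid_inequality:
  fixes f :: "('i \<Rightarrow> 'a) \<Rightarrow> real"
  assumes finite_A: "finite A" and finite_p: "\<And>i. finite (set_pmf (p i))" and t_pos: "t > 0"
    and c_pos: "(\<Sum>i\<in>A. (c i)\<^sup>2) > 0" and bounded: "\<And>D i a. i \<in> A \<Longrightarrow> f (D(i := a)) \<le> f D + c i"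
  shows "measure_pmf.prob (Pi_pmf A d p) {D. f D \<ge> measure_pmf.expectation (Pi_pmf A d p) f + t}
    \<le> exp (- 2 * t\<^sup>2 / (\<Sum>i\<in>A. (c i)\<^sup>2))"
proof -
  let ?E = "measure_pmf.expectation (Pi_pmf A d p)" and ?C = "\<Sum>i\<in>A. (c i)\<^sup>2"
  let ?tail = "{D. f D \<ge> ?E f + t}"
  define l where "l = 4 * t / ?C"
  have l_pos: "l > 0" using c_pos t_pos by (simp add: l_def)
  have "measure_pmf.prob (Pi_pmf A d p) ?tail = ?E (indicator ?tail)"
    by simp
  also have "\<dots> \<le> ?E (\<lambda>D. exp (- l * t) * exp (l * (f D - ?E f)))"
  proof (intro pmf_expectation_mono finite_set_Pi_pmf finite_A finite_p)
    fix D
    have "l * (?E f + t) \<le> l * f D" if "D \<in> ?tail" using l_pos that by (intro mult_left_mono) auto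
    then show "indicator ?tail D \<le> exp (- l * t) * exp (l * (f D - ?E f))"
      by (auto simp: indicator_def algebra_simps simp flip: exp_add)
  qed
  also have "\<dots> = exp (- l * t) * ?E (\<lambda>D. exp (l * (f D - ?E f)))"
    by simp
  also have "\<dots> \<le> exp (- l * t) * exp (l\<^sup>2 * ?C / 8)"
    using bounded by (intro mult_left_mono bounded_differences_mgf finite_A finite_p l_pos) auto
  also have "\<dots> = exp (- 2 * t\<^sup>2 / ?C)"
    using c_pos by (simp add: l_def field_simps power2_eq_square flip: exp_add)
  finally show ?thesis .
qed

lemma expectation_norm_sum_squared:
  fixes X :: "'i \<Rightarrow> 'a \<Rightarrow> 'v::euclidean_space"
  assumes finite_A: "finite A" and finite_p: "\<And>i. finite (set_pmf (p i))"
    and centered: "\<And>i. measure_pmf.expectation (p i) (X i) = 0"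
  shows "measure_pmf.expectation (Pi_pmf A d p) (\<lambda>D. (norm (\<Sum>i\<in>A. X i (D i)))\<^sup>2)
    = (\<Sum>i\<in>A. measure_pmf.expectation (p i) (\<lambda>a. (norm (X i a))\<^sup>2))"
  using finite_A
proof (induction A)
  case empty
  then show ?case by simp
next
  case (insert i A)
  let ?second_moment = "measure_pmf.expectation (p i) (\<lambda>a. (norm (X i a))\<^sup>2)"
  have integrable: "integrable (p i) h" for h :: "'a \<Rightarrow> 'b::{banach, second_countable_topology}"
    by (rule integrable_measure_pmf_finite[OF finite_p])
  have uncorrelated: "measure_pmf.expectation (p i) (\<lambda>a. X i a \<bullet> w) = 0" for w
    by (simp add: integral_inner_left integrable centered)
  have "measure_pmf.expectation (p i) (\<lambda>a. (norm (X i a + w))\<^sup>2) = ?second_moment + (norm w)\<^sup>2" for w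
  proof -
    have "(norm (X i a + w))\<^sup>2 = (norm (X i a))\<^sup>2 + 2 * (X i a \<bullet> w) + (norm w)\<^sup>2" for a
      by (simp add: power2_norm_eq_inner inner_add inner_commute)
    then show ?thesis by (simp add: integrable uncorrelated)
  qed
  moreover have "(\<Sum>j\<in>insert i A. X j ((D(i := a)) j)) = X i a + (\<Sum>j\<in>A. X j (D j))" for D a
    using insert.hyps by (auto intro!: sum.cong)
  ultimately show ?case
    using insert
    by (simp only: expectation_Pi_pmf_insert[OF insert.hyps finite_p])
      (simp add: integrable_measure_pmf_finite finite_set_Pi_pmf finite_p)
qed

corollary expectation_norm_sum_le:
  fixes X :: "'i \<Rightarrow> 'a \<Rightarrow> 'v::euclidean_space"
  assumes "finite A" "\<And>i. finite (set_pmf (p i))" "\<And>i. measure_pmf.expectation (p i) (X i) = 0"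
  shows "measure_pmf.expectation (Pi_pmf A d p) (\<lambda>D. norm (\<Sum>i\<in>A. X i (D i)))
    \<le> sqrt (\<Sum>i\<in>A. measure_pmf.expectation (p i) (\<lambda>a. (norm (X i a))\<^sup>2))"
  by (rule order_trans[OF pmf_expectation_le_sqrt[OF finite_set_Pi_pmf[OF assms(1,2)]]])
    (simp only: expectation_norm_sum_squared[OF assms] order_refl)

lemma finite_set_sample_pmf: "finite (set_pmf p) \<Longrightarrow> finite (set_pmf (sample_pmf N p))"
  by (simp add: sample_pmf_def finite_set_Pi_pmf)

lemma sample_pmf_component_in_support:
  "D \<in> set_pmf (sample_pmf N p) \<Longrightarrow> j < N \<Longrightarrow> D j \<in> set_pmf p"
  by (auto simp: sample_pmf_def set_Pi_pmf PiE_dflt_def)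

lemma expectation_sample_pmf_component:
  fixes h :: "'a \<Rightarrow> 'v::{banach, second_countable_topology}"
  shows "j < N \<Longrightarrow> measure_pmf.expectation (sample_pmf N p) (\<lambda>D. h (D j))
    = measure_pmf.expectation p h"
  unfolding sample_pmf_def by (rule expectation_Pi_pmf_component) auto

lemma expectation_sample_pmf_sum:
  fixes h :: "'a \<Rightarrow> real"
  assumes "finite (set_pmf p)"
  shows "measure_pmf.expectation (sample_pmf N p) (\<lambda>D. \<Sum>j<N. h (D j))
    = N * measure_pmf.expectation p h"
  using assms
  by (simp add: integrable_measure_pmf_finite finite_set_sample_pmf
      expectation_sample_pmf_component)

text \<open>Outside \<open>{..<N}\<close> the components of a sample are \<open>undefined\<close>, which neither \<open>h\<close> nor pairing
  need preserve; hence \<open>f\<close> may only depend on the first \<open>N\<close> components.\<close>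

lemma expectation_sample_pmf_map:
  fixes f :: "(nat \<Rightarrow> 'b) \<Rightarrow> real"
  assumes f_local: "\<And>S S'. (\<And>j. j < N \<Longrightarrow> S j = S' j) \<Longrightarrow> f S = f S'"
  shows "measure_pmf.expectation (sample_pmf N (map_pmf h q)) f
    = measure_pmf.expectation (sample_pmf N q) (\<lambda>S. f (\<lambda>j. h (S j)))"
proof -
  have "sample_pmf N (map_pmf h q)
      = map_pmf (\<lambda>S j. if j < N then S j else undefined)
          (Pi_pmf {..<N} (h undefined) (\<lambda>_. map_pmf h q))"
    using Pi_pmf_default_swap[of "{..<N}" undefined "h undefined" "\<lambda>_. map_pmf h q"]
    by (simp add: sample_pmf_def)
  also have "\<dots> = map_pmf (\<lambda>S j. if j < N then h (S j) else undefined) (sample_pmf N q)"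
    by (simp add: Pi_pmf_map[of _ _ undefined] sample_pmf_def pmf.map_comp o_def)
  finally have "measure_pmf.expectation (sample_pmf N (map_pmf h q)) f
      = measure_pmf.expectation (sample_pmf N q) (\<lambda>S. f (\<lambda>j. if j < N then h (S j) else undefined))"
    by simp
  also have "\<dots> = measure_pmf.expectation (sample_pmf N q) (\<lambda>S. f (\<lambda>j. h (S j)))"
    by (intro Bochner_Integration.integral_cong refl f_local) simp
  finally show ?thesis .
qed

lemma expectation_sample_pmf_pair:
  fixes f :: "(nat \<Rightarrow> 'a \<times> 'b) \<Rightarrow> real"
  assumes finite_p: "finite (set_pmf p)" and finite_q: "finite (set_pmf q)"
    and f_local: "\<And>S S'. (\<And>j. j < N \<Longrightarrow> S j = S' j) \<Longrightarrow> f S = f S'"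
  shows "measure_pmf.expectation (sample_pmf N (pair_pmf p q)) f
    = measure_pmf.expectation (sample_pmf N p)
        (\<lambda>D. measure_pmf.expectation (sample_pmf N q) (\<lambda>D'. f (\<lambda>j. (D j, D' j))))"
proof -
  have "sample_pmf N (pair_pmf p q)
      = bind_pmf (sample_pmf N p)
          (\<lambda>D. Pi_pmf {..<N} undefined (\<lambda>j. bind_pmf q (\<lambda>b. return_pmf (D j, b))))"
    unfolding sample_pmf_def pair_pmf_def by (rule Pi_pmf_bind) simp
  also have "\<dots> = bind_pmf (sample_pmf N p) (\<lambda>D. bind_pmf (sample_pmf N q)
      (\<lambda>D'. return_pmf (\<lambda>j. if j < N then (D j, D' j) else undefined)))"
    by (simp add: Pi_pmf_bind[where d' = undefined] sample_pmf_def)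
  also have "\<dots> = map_pmf (\<lambda>(D, D') j. if j < N then (D j, D' j) else undefined)
      (pair_pmf (sample_pmf N p) (sample_pmf N q))"
    by (simp add: pair_pmf_def map_pmf_def bind_assoc_pmf bind_return_pmf)
  finally have "measure_pmf.expectation (sample_pmf N (pair_pmf p q)) f
      = measure_pmf.expectation (sample_pmf N p) (\<lambda>D. measure_pmf.expectation (sample_pmf N q)
          (\<lambda>D'. f (\<lambda>j. if j < N then (D j, D' j) else undefined)))"
    using finite_p finite_q by (simp add: expectation_pair_pmf finite_set_sample_pmf)
  also have "\<dots> = measure_pmf.expectation (sample_pmf N p)
        (\<lambda>D. measure_pmf.expectation (sample_pmf N q) (\<lambda>D'. f (\<lambda>j. (D j, D' j))))"
    by (intro Bochner_Integration.integral_cong refl f_local) simp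
  finally show ?thesis .
qed

section \<open>Rademacher complexity and symmetrization\<close>

definition emp_mean :: "nat \<Rightarrow> ('a \<Rightarrow> real) \<Rightarrow> (nat \<Rightarrow> 'a) \<Rightarrow> real" where
  "emp_mean N h D = (\<Sum>j<N. h (D j)) / real N"

definition uniform_deviation ::
    "nat \<Rightarrow> 'a pmf \<Rightarrow> 'i set \<Rightarrow> ('i \<Rightarrow> 'a \<Rightarrow> real) \<Rightarrow> (nat \<Rightarrow> 'a) \<Rightarrow> real" where
  "uniform_deviation N p I g D = (SUP i\<in>I. measure_pmf.expectation p (g i) - emp_mean N (g i) D)"

definition ghost_deviation ::
    "nat \<Rightarrow> 'i set \<Rightarrow> ('i \<Rightarrow> 'a \<Rightarrow> real) \<Rightarrow> (nat \<Rightarrow> 'a) \<Rightarrow> (nat \<Rightarrow> 'a) \<Rightarrow> real" where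
  "ghost_deviation N I g D' D = (SUP i\<in>I. emp_mean N (g i) D' - emp_mean N (g i) D)"

definition signed_sup ::
    "nat \<Rightarrow> 'i set \<Rightarrow> ('i \<Rightarrow> 'a \<Rightarrow> real) \<Rightarrow> (nat \<Rightarrow> real) \<Rightarrow> (nat \<Rightarrow> 'a) \<Rightarrow> real" where
  "signed_sup N I g s D = (SUP i\<in>I. (\<Sum>j<N. s j * g i (D j)) / sqrt (real N))"

definition rademacher_complexity :: "nat \<Rightarrow> 'a pmf \<Rightarrow> 'i set \<Rightarrow> ('i \<Rightarrow> 'a \<Rightarrow> real) \<Rightarrow> real" where
  "rademacher_complexity N p I g = measure_pmf.expectation (sample_pmf N (pair_pmf p rademacher))
     (\<lambda>S. signed_sup N I g (\<lambda>j. snd (S j)) (\<lambda>j. fst (S j)))"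

lemma set_pmf_rademacher: "set_pmf rademacher = {-1, 1}"
  by (simp add: rademacher_def)

lemma finite_set_pair_rademacher: "finite (set_pmf p) \<Longrightarrow> finite (set_pmf (pair_pmf p rademacher))"
  by (simp add: set_pmf_rademacher)

lemma expectation_rademacher: "measure_pmf.expectation rademacher f = (f (-1) + f 1) / 2"
  for f :: "real \<Rightarrow> real"
  by (simp add: rademacher_def integral_pmf_of_set)

lemma map_uminus_rademacher: "map_pmf uminus rademacher = rademacher"
  unfolding rademacher_def by (subst map_pmf_of_set_inj) (auto simp: insert_commute)

lemma expectation_pair_rademacher:
  fixes f :: "'a \<times> real \<Rightarrow> real"
  assumes "finite (set_pmf p)"
  shows "measure_pmf.expectation (pair_pmf p rademacher) f
    = measure_pmf.expectation p (\<lambda>z. (f (z, -1) + f (z, 1)) / 2)"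
  using assms by (simp add: expectation_pair_pmf set_pmf_rademacher expectation_rademacher)

lemma map_pmf_random_swap:
  "map_pmf (\<lambda>(z, s). if s = 1 then z else prod.swap z) (pair_pmf (pair_pmf p p) rademacher)
    = pair_pmf p p"
proof -
  have swap_invariant: "map_pmf (\<lambda>z. if s = 1 then z else prod.swap z) (pair_pmf p p)
      = pair_pmf p p" for s :: real
    using pair_commute_pmf[of p p]
    by (cases "s = 1") (simp_all add: prod.swap_def[abs_def] case_prod_unfold map_pmf_ident)
  have "map_pmf (\<lambda>(z, s). if s = 1 then z else prod.swap z) (pair_pmf (pair_pmf p p) rademacher)
      = bind_pmf rademacher (\<lambda>s. map_pmf (\<lambda>z. if s = 1 then z else prod.swap z) (pair_pmf p p))"
    by (subst pair_commute_pmf) (simp add: pair_pmf_def map_pmf_def bind_assoc_pmf bind_return_pmf)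
  then show ?thesis by (simp add: swap_invariant)
qed

lemma ghost_deviation_cong:
  assumes "\<And>j. j < N \<Longrightarrow> T j = T' j"
  shows "ghost_deviation N I g (\<lambda>j. fst (T j)) (\<lambda>j. snd (T j))
    = ghost_deviation N I g (\<lambda>j. fst (T' j)) (\<lambda>j. snd (T' j))"
  using assms by (simp add: ghost_deviation_def emp_mean_def cong: sum.cong_simp)

lemma signed_sup_cong:
  assumes "\<And>j. j < N \<Longrightarrow> S j = S' j"
  shows "signed_sup N I g (\<lambda>j. snd (S j)) (\<lambda>j. fst (S j))
    = signed_sup N I g (\<lambda>j. snd (S' j)) (\<lambda>j. fst (S' j))"
  using assms by (simp add: signed_sup_def cong: sum.cong_simp)

lemma rademacher_complexity_eq_expectation_map:
  assumes "map_pmf h q = pair_pmf p rademacher"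
  shows "rademacher_complexity N p I g = measure_pmf.expectation (sample_pmf N q)
      (\<lambda>T. signed_sup N I g (\<lambda>j. snd (h (T j))) (\<lambda>j. fst (h (T j))))"
  unfolding rademacher_complexity_def assms[symmetric]
  by (rule expectation_sample_pmf_map) (rule signed_sup_cong)

lemma expectation_emp_mean:
  assumes "finite (set_pmf p)" "N > 0"
  shows "measure_pmf.expectation (sample_pmf N p) (emp_mean N h) = measure_pmf.expectation p h"
  using assms expectation_sample_pmf_sum[of p N h]
  by (simp add: emp_mean_def[abs_def] del: Bochner_Integration.integral_sum)

lemma emp_mean_update_le:
  assumes "\<And>x y. h x - h y \<le> c" "j < N"
  shows "emp_mean N h (D(j := a)) \<le> emp_mean N h D + c / real N"
proof -
  have split: "(\<Sum>k<N. h (D' k)) = h (D' j) + (\<Sum>k\<in>{..<N} - {j}. h (D' k))" for D'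
    using assms(2) by (intro sum.remove) auto
  have "(\<Sum>k\<in>{..<N} - {j}. h ((D(j := a)) k)) = (\<Sum>k\<in>{..<N} - {j}. h (D k))"
    by (intro sum.cong) auto
  then have "(\<Sum>k<N. h ((D(j := a)) k)) \<le> (\<Sum>k<N. h (D k)) + c"
    using assms(1)[of a "D j"] by (simp add: split)
  then show ?thesis
    unfolding emp_mean_def add_divide_distrib[symmetric] by (rule divide_right_mono) simp
qed

lemma signed_sum_le_signed_sup:
  assumes g_bounded: "\<And>i z. i \<in> I \<Longrightarrow> \<bar>g i z\<bar> \<le> B" and "i \<in> I"
  shows "(\<Sum>j<N. s j * g i (D j)) / sqrt (real N) \<le> signed_sup N I g s D"
  unfolding signed_sup_def
proof (rule cSUP_upper[OF \<open>i \<in> I\<close> bdd_aboveI2])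
  fix i assume "i \<in> I"
  then have "s j * g i (D j) \<le> \<bar>s j\<bar> * B" for j
    using g_bounded[of i "D j"] mult_left_mono[of "\<bar>g i (D j)\<bar>" B "\<bar>s j\<bar>"]
      abs_ge_self[of "s j * g i (D j)"]
    by (simp add: abs_mult)
  then show "(\<Sum>j<N. s j * g i (D j)) / sqrt (real N) \<le> (\<Sum>j<N. \<bar>s j\<bar> * B) / sqrt (real N)"
    by (intro divide_right_mono sum_mono) auto
qed

lemma rademacher_complexity_nonneg:
  assumes finite_p: "finite (set_pmf p)" and I_nonempty: "I \<noteq> {}"
    and g_bounded: "\<And>i z. i \<in> I \<Longrightarrow> \<bar>g i z\<bar> \<le> B"
  shows "0 \<le> rademacher_complexity N p I g"
proof -
  obtain i where i_in_I: "i \<in> I" using I_nonempty by blast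
  let ?S = "sample_pmf N (pair_pmf p rademacher)"
  have finite_q: "finite (set_pmf (pair_pmf p rademacher))"
    using finite_p by (rule finite_set_pair_rademacher)
  have "measure_pmf.expectation (pair_pmf p rademacher) (\<lambda>z. snd z * g i (fst z)) = 0"
    using finite_p by (simp add: expectation_pair_rademacher)
  then have "0 = measure_pmf.expectation ?S
      (\<lambda>S. (\<Sum>j<N. snd (S j) * g i (fst (S j))) / sqrt (real N))"
    using expectation_sample_pmf_sum[OF finite_q, of N "\<lambda>z. snd z * g i (fst z)"]
    by (simp del: Bochner_Integration.integral_sum)
  also have "\<dots> \<le> rademacher_complexity N p I g"
    unfolding rademacher_complexity_def
    by (intro pmf_expectation_mono finite_set_sample_pmf finite_q
        signed_sum_le_signed_sup[OF g_bounded] i_in_I)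
  finally show ?thesis .
qed

lemma deviation_le_ghost_deviation:
  assumes N_pos: "N > 0" and g_bounded: "\<And>i z. i \<in> I \<Longrightarrow> \<bar>g i z\<bar> \<le> B" and "i \<in> I"
  shows "emp_mean N (g i) D' - emp_mean N (g i) D \<le> ghost_deviation N I g D' D"
  unfolding ghost_deviation_def
proof (rule cSUP_upper[OF \<open>i \<in> I\<close> bdd_aboveI2])
  fix i assume i_in_I: "i \<in> I"
  have "\<bar>emp_mean N (g i) D\<bar> \<le> B" for D
  proof -
    have "\<bar>\<Sum>j<N. g i (D j)\<bar> \<le> (\<Sum>j<N. B)"
      by (rule order_trans[OF sum_abs sum_mono]) (simp add: g_bounded i_in_I)
    then show ?thesis using N_pos by (simp add: emp_mean_def field_simps)
  qed
  from this[of D] this[of D'] show "emp_mean N (g i) D' - emp_mean N (g i) D \<le> 2 * B"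
    by linarith
qed

lemma expectation_uniform_deviation_le_ghost_deviation:
  assumes finite_p: "finite (set_pmf p)" and N_pos: "N > 0" and I_nonempty: "I \<noteq> {}"
    and g_bounded: "\<And>i z. i \<in> I \<Longrightarrow> \<bar>g i z\<bar> \<le> B"
  shows "measure_pmf.expectation (sample_pmf N p) (uniform_deviation N p I g)
    \<le> measure_pmf.expectation (sample_pmf N (pair_pmf p p))
        (\<lambda>T. ghost_deviation N I g (\<lambda>j. fst (T j)) (\<lambda>j. snd (T j)))"
proof -
  let ?S = "sample_pmf N p"
  have finite_S: "finite (set_pmf ?S)" using finite_p by (rule finite_set_sample_pmf)
  have "measure_pmf.expectation ?S (uniform_deviation N p I g)
    \<le> measure_pmf.expectation ?S (\<lambda>D. measure_pmf.expectation ?S (\<lambda>D'. ghost_deviation N I g D' D))"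
  proof (intro pmf_expectation_mono finite_S)
    fix D
    have "measure_pmf.expectation p (g i) - emp_mean N (g i) D
      \<le> measure_pmf.expectation ?S (\<lambda>D'. ghost_deviation N I g D' D)" if i_in_I: "i \<in> I" for i
    proof -
      have "measure_pmf.expectation p (g i) - emp_mean N (g i) D
          = measure_pmf.expectation ?S (\<lambda>D'. emp_mean N (g i) D' - emp_mean N (g i) D)"
        by (simp add: integrable_measure_pmf_finite finite_S
            expectation_emp_mean[OF finite_p N_pos])
      also have "\<dots> \<le> measure_pmf.expectation ?S (\<lambda>D'. ghost_deviation N I g D' D)"
        by (intro pmf_expectation_mono finite_S deviation_le_ghost_deviation[OF N_pos g_bounded]
            i_in_I)
      finally show ?thesis .
    qed
    then show "uniform_deviation N p I g D
      \<le> measure_pmf.expectation ?S (\<lambda>D'. ghost_deviation N I g D' D)"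
      unfolding uniform_deviation_def by (intro cSUP_least I_nonempty)
  qed
  also have "\<dots> = measure_pmf.expectation ?S
      (\<lambda>D'. measure_pmf.expectation ?S (\<lambda>D. ghost_deviation N I g D' D))"
    by (rule expectation_swap[OF finite_S finite_S])
  also have "\<dots> = measure_pmf.expectation (sample_pmf N (pair_pmf p p))
      (\<lambda>T. ghost_deviation N I g (\<lambda>j. fst (T j)) (\<lambda>j. snd (T j)))"
    by (subst expectation_sample_pmf_pair[OF finite_p finite_p])
      (rule ghost_deviation_cong, simp_all)
  finally show ?thesis .
qed

lemma ghost_deviation_swap_le:
  fixes s :: "nat \<Rightarrow> real"
  assumes I_nonempty: "I \<noteq> {}" and g_bounded: "\<And>i z. i \<in> I \<Longrightarrow> \<bar>g i z\<bar> \<le> B"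
    and s_sign: "\<And>j. j < N \<Longrightarrow> s j \<in> {-1, 1}"
  shows "ghost_deviation N I g (\<lambda>j. if s j = 1 then x j else y j) (\<lambda>j. if s j = 1 then y j else x j)
    \<le> (signed_sup N I g s x + signed_sup N I g (\<lambda>j. - s j) y) / sqrt (real N)"
  unfolding ghost_deviation_def
proof (rule cSUP_least[OF I_nonempty])
  fix i assume i_in_I: "i \<in> I"
  have signed: "g i (if s j = 1 then x j else y j) - g i (if s j = 1 then y j else x j)
      = s j * g i (x j) + - s j * g i (y j)" if "j < N" for j
    using s_sign[OF that] by auto
  have "emp_mean N (g i) (\<lambda>j. if s j = 1 then x j else y j)
        - emp_mean N (g i) (\<lambda>j. if s j = 1 then y j else x j)
      = (\<Sum>j<N. s j * g i (x j) + - s j * g i (y j)) / real N"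
    unfolding emp_mean_def diff_divide_distrib[symmetric] sum_subtractf[symmetric]
    using signed by (simp cong: sum.cong_simp)
  also have "\<dots> = ((\<Sum>j<N. s j * g i (x j)) / sqrt (real N)
      + (\<Sum>j<N. - s j * g i (y j)) / sqrt (real N)) / sqrt (real N)"
    by (simp only: sum.distrib add_divide_distrib divide_divide_eq_left real_sqrt_mult_self
        abs_of_nat)
  also have "\<dots> \<le> (signed_sup N I g s x + signed_sup N I g (\<lambda>j. - s j) y) / sqrt (real N)"
    by (intro divide_right_mono add_mono signed_sum_le_signed_sup[OF g_bounded] i_in_I) auto
  finally show "emp_mean N (g i) (\<lambda>j. if s j = 1 then x j else y j)
      - emp_mean N (g i) (\<lambda>j. if s j = 1 then y j else x j)
    \<le> (signed_sup N I g s x + signed_sup N I g (\<lambda>j. - s j) y) / sqrt (real N)" .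
qed

lemma expectation_ghost_deviation_le_rademacher_complexity:
  assumes finite_p: "finite (set_pmf p)" and I_nonempty: "I \<noteq> {}"
    and g_bounded: "\<And>i z. i \<in> I \<Longrightarrow> \<bar>g i z\<bar> \<le> B"
  shows "measure_pmf.expectation (sample_pmf N (pair_pmf p p))
      (\<lambda>T. ghost_deviation N I g (\<lambda>j. fst (T j)) (\<lambda>j. snd (T j)))
    \<le> 2 * rademacher_complexity N p I g / sqrt (real N)"
proof -
  let ?q = "pair_pmf (pair_pmf p p) rademacher" and ?R = "rademacher_complexity N p I g"
  let ?E = "measure_pmf.expectation (sample_pmf N ?q)"
  let ?swap = "\<lambda>(z, s :: real). if s = 1 then z else prod.swap z"
  let ?left = "\<lambda>T. signed_sup N I g (\<lambda>j. snd (T j)) (\<lambda>j. fst (fst (T j)))"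
  let ?right = "\<lambda>T. signed_sup N I g (\<lambda>j. - snd (T j)) (\<lambda>j. snd (fst (T j)))"
  have finite_S: "finite (set_pmf (sample_pmf N ?q))"
    using finite_p by (intro finite_set_sample_pmf finite_set_pair_rademacher) simp
  have "map_pmf (\<lambda>z. (fst (fst z), snd z)) ?q = pair_pmf p rademacher"
    using map_pair[of fst "\<lambda>x. x" "pair_pmf p p" rademacher]
    by (simp add: case_prod_unfold map_fst_pair_pmf)
  then have left: "?E ?left = ?R"
    by (simp add: rademacher_complexity_eq_expectation_map)
  have "map_pmf (\<lambda>z. (snd (fst z), - snd z)) ?q = pair_pmf p rademacher"
    using map_pair[of snd uminus "pair_pmf p p" rademacher]
    by (simp add: case_prod_unfold map_snd_pair_pmf map_uminus_rademacher)
  then have right: "?E ?right = ?R"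
    by (simp add: rademacher_complexity_eq_expectation_map)
  \<comment> \<open>Exchanging the two copies by fair signs keeps their law and puts a sign on each difference.\<close>
  have "measure_pmf.expectation (sample_pmf N (pair_pmf p p))
      (\<lambda>T. ghost_deviation N I g (\<lambda>j. fst (T j)) (\<lambda>j. snd (T j)))
    = ?E (\<lambda>T. ghost_deviation N I g (\<lambda>j. fst (?swap (T j))) (\<lambda>j. snd (?swap (T j))))"
    by (subst map_pmf_random_swap[symmetric], rule expectation_sample_pmf_map)
      (rule ghost_deviation_cong)
  also have "\<dots> \<le> ?E (\<lambda>T. (?left T + ?right T) / sqrt (real N))"
  proof (rule pmf_expectation_mono[OF finite_S])
    fix T assume T_in_support: "T \<in> set_pmf (sample_pmf N ?q)"
    have "snd (T j) \<in> {-1, 1}" if "j < N" for j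
      using sample_pmf_component_in_support[OF T_in_support that] by (auto simp: set_pmf_rademacher)
    then show "ghost_deviation N I g (\<lambda>j. fst (?swap (T j))) (\<lambda>j. snd (?swap (T j)))
        \<le> (?left T + ?right T) / sqrt (real N)"
      using ghost_deviation_swap_le[where g = g and s = "\<lambda>j. snd (T j)", OF I_nonempty g_bounded]
      by (simp add: case_prod_unfold if_distrib[of fst] if_distrib[of snd] cong: if_cong)
  qed
  also have "\<dots> = 2 * ?R / sqrt (real N)"
    by (simp add: integrable_measure_pmf_finite[OF finite_S] left right)
  finally show ?thesis .
qed

theorem symmetrization:
  assumes "finite (set_pmf p)" "N > 0" "I \<noteq> {}" "\<And>i z. i \<in> I \<Longrightarrow> \<bar>g i z\<bar> \<le> B"
  shows "measure_pmf.expectation (sample_pmf N p) (uniform_deviation N p I g)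
    \<le> 2 * rademacher_complexity N p I g / sqrt (real N)"
  using expectation_uniform_deviation_le_ghost_deviation[OF assms]
    expectation_ghost_deviation_le_rademacher_complexity[OF assms(1,3,4)]
  by (rule order_trans)

section \<open>Empirical risk minimization\<close>

lemma deviation_le_uniform_deviation:
  assumes g_unit: "\<And>i z. i \<in> I \<Longrightarrow> g i z \<in> {0..1}" and finite_p: "finite (set_pmf p)" and "i \<in> I"
  shows "measure_pmf.expectation p (g i) - emp_mean N (g i) D \<le> uniform_deviation N p I g D"
  unfolding uniform_deviation_def
proof (rule cSUP_upper[OF \<open>i \<in> I\<close> bdd_aboveI2])
  fix i assume i_in_I: "i \<in> I"
  have "measure_pmf.expectation p (g i) \<le> measure_pmf.expectation p (\<lambda>_. 1)"
    using g_unit[OF i_in_I] by (intro pmf_expectation_mono finite_p) simp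
  moreover have "0 \<le> emp_mean N (g i) D"
    using g_unit[OF i_in_I] by (auto simp: emp_mean_def intro!: divide_nonneg_nonneg sum_nonneg)
  ultimately show "measure_pmf.expectation p (g i) - emp_mean N (g i) D \<le> 1" by simp
qed

lemma uniform_deviation_update_le:
  assumes g_unit: "\<And>i z. i \<in> I \<Longrightarrow> g i z \<in> {0..1}" and finite_p: "finite (set_pmf p)"
    and I_nonempty: "I \<noteq> {}" and j_less: "j < N"
  shows "uniform_deviation N p I g (D(j := a)) \<le> uniform_deviation N p I g D + 1 / real N"
  unfolding uniform_deviation_def[of N p I g "D(j := a)"]
proof (rule cSUP_least[OF I_nonempty])
  fix i assume i_in_I: "i \<in> I"
  have "g i x - g i y \<le> 1" for x y using g_unit[OF i_in_I, of x] g_unit[OF i_in_I, of y] by simp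
  then have "emp_mean N (g i) D \<le> emp_mean N (g i) (D(j := a)) + 1 / real N"
    using emp_mean_update_le[of "g i" 1 j N "D(j := a)" "D j"] j_less by simp
  then show "measure_pmf.expectation p (g i) - emp_mean N (g i) (D(j := a))
      \<le> uniform_deviation N p I g D + 1 / real N"
    using deviation_le_uniform_deviation[where g = g and N = N and D = D, OF g_unit finite_p i_in_I]
    by simp
qed

lemma McDiarmid_sample_confidence:
  fixes f :: "(nat \<Rightarrow> 'a) \<Rightarrow> real"
  assumes finite_p: "finite (set_pmf p)" and N_pos: "N > 0" and delta: "0 < \<delta>" "\<delta> < 1"
    and c_pos: "c > 0"
    and bounded: "\<And>D j a. j < N \<Longrightarrow> f (D(j := a)) \<le> f D + c / real N"
  shows "1 - \<delta> \<le> measure_pmf.prob (sample_pmf N p)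
    {D. f D < measure_pmf.expectation (sample_pmf N p) f + c * sqrt (ln (1 / \<delta>) / (2 * real N))}"
proof -
  let ?P = "measure_pmf.prob (sample_pmf N p)" and ?E = "measure_pmf.expectation (sample_pmf N p)"
  define t where "t = c * sqrt (ln (1 / \<delta>) / (2 * real N))"
  have ln_pos: "0 < ln (1 / \<delta>)" using delta by simp
  have "?P {D. f D \<ge> ?E f + t} \<le> exp (- 2 * t\<^sup>2 / (\<Sum>j<N. (c / real N)\<^sup>2))"
    unfolding sample_pmf_def
    by (rule McDiarmid_inequality)
      (use finite_p N_pos c_pos bounded ln_pos in \<open>auto simp: t_def algebra_simps\<close>)
  also have "- 2 * t\<^sup>2 / (\<Sum>j<N. (c / real N)\<^sup>2) = - ln (1 / \<delta>)"
    using N_pos c_pos ln_pos by (simp add: t_def power_mult_distrib power2_eq_square field_simps)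
  also have "exp (- ln (1 / \<delta>)) = \<delta>"
    using delta by (simp add: exp_minus)
  finally have "?P {D. f D \<ge> ?E f + t} \<le> \<delta>" .
  moreover have "?P (UNIV - {D. f D \<ge> ?E f + t}) = 1 - ?P {D. f D \<ge> ?E f + t}"
    using measure_pmf.prob_compl[of "{D. f D \<ge> ?E f + t}" "sample_pmf N p"] by simp
  moreover have "UNIV - {D. f D \<ge> ?E f + t} = {D. f D < ?E f + t}" by auto
  ultimately show ?thesis by (simp add: t_def)
qed

lemma minimal_emp_mean_update_le:
  assumes g_unit: "\<And>i z. i \<in> I \<Longrightarrow> g i z \<in> {0..1}" and j_less: "j < N"
    and ihat_minimizes: "\<And>D. ihat D \<in> I"
      "\<And>D i. i \<in> I \<Longrightarrow> emp_mean N (g (ihat D)) D \<le> emp_mean N (g i) D"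
  shows "emp_mean N (g (ihat (D(j := a)))) (D(j := a)) \<le> emp_mean N (g (ihat D)) D + 1 / real N"
proof -
  have oscillation: "g (ihat D) x - g (ihat D) y \<le> 1" for x y
    using g_unit[OF ihat_minimizes(1), of D x] g_unit[OF ihat_minimizes(1), of D y] by simp
  have "emp_mean N (g (ihat (D(j := a)))) (D(j := a)) \<le> emp_mean N (g (ihat D)) (D(j := a))"
    by (intro ihat_minimizes)
  also have "\<dots> \<le> emp_mean N (g (ihat D)) D + 1 / real N"
    using oscillation j_less by (rule emp_mean_update_le)
  finally show ?thesis .
qed

lemma expectation_deviation_plus_minimum_le:
  assumes finite_p: "finite (set_pmf p)" and N_pos: "N > 0"
    and g_unit: "\<And>i z. i \<in> I \<Longrightarrow> g i z \<in> {0..1}"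
    and minimal: "\<And>D i. i \<in> I \<Longrightarrow> emp_mean N (g (ihat D)) D \<le> emp_mean N (g i) D" and i_in_I: "i \<in> I"
  shows "measure_pmf.expectation (sample_pmf N p)
      (\<lambda>D. uniform_deviation N p I g D + emp_mean N (g (ihat D)) D)
    \<le> 2 * rademacher_complexity N p I g / sqrt (real N) + measure_pmf.expectation p (g i)"
proof -
  let ?E = "measure_pmf.expectation (sample_pmf N p)"
  have finite_S: "finite (set_pmf (sample_pmf N p))" using finite_p by (rule finite_set_sample_pmf)
  have "\<bar>g i z\<bar> \<le> 1" if "i \<in> I" for i z using g_unit[OF that, of z] by simp
  then have "?E (uniform_deviation N p I g) \<le> 2 * rademacher_complexity N p I g / sqrt (real N)"
    using i_in_I by (intro symmetrization[OF finite_p N_pos]) auto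
  moreover have "?E (\<lambda>D. emp_mean N (g (ihat D)) D) \<le> ?E (emp_mean N (g i))"
    by (intro pmf_expectation_mono finite_S minimal i_in_I)
  ultimately show ?thesis
    by (simp add: integrable_measure_pmf_finite[OF finite_S]
        expectation_emp_mean[OF finite_p N_pos])
qed

theorem empirical_risk_minimizer_excess_risk:
  fixes p :: "'a pmf" and g :: "'i \<Rightarrow> 'a \<Rightarrow> real" and ihat :: "(nat \<Rightarrow> 'a) \<Rightarrow> 'i"
  assumes finite_p: "finite (set_pmf p)" and N_pos: "N > 0" and delta: "0 < \<delta>" "\<delta> < 1"
    and g_unit: "\<And>i z. i \<in> I \<Longrightarrow> g i z \<in> {0..1}"
    and ihat_minimizes: "\<And>D. ihat D \<in> I"
      "\<And>D i. i \<in> I \<Longrightarrow> emp_mean N (g (ihat D)) D \<le> emp_mean N (g i) D"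
  shows "1 - \<delta> \<le> measure_pmf.prob (sample_pmf N p)
    {D. \<forall>i\<in>I. measure_pmf.expectation p (g (ihat D)) \<le> measure_pmf.expectation p (g i)
      + 2 * rademacher_complexity N p I g / sqrt (real N) + sqrt (2 / real N * ln (1 / \<delta>))}"
    (is "_ \<le> measure_pmf.prob ?S ?good")
proof -
  let ?E = "measure_pmf.expectation ?S"
  define F where "F D = uniform_deviation N p I g D + emp_mean N (g (ihat D)) D" for D
  have I_nonempty: "I \<noteq> {}" using ihat_minimizes(1) by auto
  have "F (D(j := a)) \<le> F D + 2 / real N" if "j < N" for D j a
    using uniform_deviation_update_le[where g = g and D = D and a = a,
        OF g_unit finite_p I_nonempty that]
      minimal_emp_mean_update_le[where g = g and ihat = ihat and D = D and a = a,
        OF g_unit that ihat_minimizes]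
    by (simp add: F_def)
  then have "1 - \<delta> \<le> measure_pmf.prob ?S {D. F D < ?E F + 2 * sqrt (ln (1 / \<delta>) / (2 * real N))}"
    by (intro McDiarmid_sample_confidence[OF finite_p N_pos delta]) simp_all
  also have "2 * sqrt (ln (1 / \<delta>) / (2 * real N)) = sqrt (2 / real N * ln (1 / \<delta>))"
    using real_sqrt_mult[of "2\<^sup>2" "ln (1 / \<delta>) / (2 * real N)"] by (simp add: field_simps)
  also have "measure_pmf.prob ?S {D. F D < ?E F + sqrt (2 / real N * ln (1 / \<delta>))}
    \<le> measure_pmf.prob ?S ?good"
  proof (intro measure_pmf.finite_measure_mono subsetI CollectI ballI)
    fix D i assume D_below: "D \<in> {D. F D < ?E F + sqrt (2 / real N * ln (1 / \<delta>))}"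
      and i_in_I: "i \<in> I"
    have "measure_pmf.expectation p (g (ihat D)) \<le> F D"
      using deviation_le_uniform_deviation[where g = g and N = N and D = D,
          OF g_unit finite_p ihat_minimizes(1)[of D]]
      by (simp add: F_def)
    moreover have "?E F \<le> 2 * rademacher_complexity N p I g / sqrt (real N)
        + measure_pmf.expectation p (g i)"
      unfolding F_def
      using finite_p N_pos g_unit ihat_minimizes(2) i_in_I
      by (rule expectation_deviation_plus_minimum_le)
    ultimately show "measure_pmf.expectation p (g (ihat D)) \<le> measure_pmf.expectation p (g i)
        + 2 * rademacher_complexity N p I g / sqrt (real N) + sqrt (2 / real N * ln (1 / \<delta>))"
      using D_below by simp
  qed simp
  finally show ?thesis .
qed

section \<open>Binary measurements and the Renyi bound\<close>

definition povm_observable :: "(bool \<Rightarrow> complex^'n^'n) \<Rightarrow> complex^'n^'n" where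
  "povm_observable M = M True - M False"

definition label_sign :: "bool \<Rightarrow> real" where
  "label_sign c = (if c then 1 else -1)"

lemma abs_label_sign: "\<bar>label_sign c\<bar> = 1"
  by (simp add: label_sign_def)

lemma povm_psd: "povm M \<Longrightarrow> psd (M c)"
  by (cases c) (auto simp: povm_def)

lemma povm_exists: "{M :: bool \<Rightarrow> complex^'n^'n. povm M} \<noteq> {}"
proof -
  have "psd (mat 1 :: complex^'n^'n)" "psd (0 :: complex^'n^'n)"
    by (simp_all add: psd_iff_psd_operator psd_operator_def selfadjoint_def)
  then have "povm (\<lambda>c. if c then mat 1 else 0 :: complex^'n^'n)" by (simp add: povm_def)
  then show ?thesis by blast
qed

lemma hermitian_povm_observable: "povm M \<Longrightarrow> hermitian (povm_observable M)"
  unfolding hermitian_iff_selfadjoint selfadjoint_def povm_observable_def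
  by (simp add: matrix_vector_mult_diff_rdistrib inner_diff_left inner_diff_right
      psd_hermitian_inner povm_psd)

lemma norm_povm_observable_mult_le:
  assumes povm_M: "povm M"
  shows "norm (povm_observable M *v v) \<le> norm v"
proof -
  let ?P = "(*v) (M True)" and ?Q = "(*v) (M False)"
  have resolution: "?P w + ?Q w = w" for w
    using povm_M by (simp add: povm_def add.commute flip: matrix_vector_mult_add_rdistrib)
  have commute: "?Q (?P w) = ?P (?Q w)" for w
  proof -
    have "?Q w = w - ?P w" for w using resolution[of w] by (simp add: algebra_simps)
    then show ?thesis by (simp only: matrix_vector_mult_diff_distrib)
  qed
  have "?P v \<bullet> ?Q v = ?P v \<bullet> ?Q (?P v + ?Q v)" by (simp only: resolution)
  also have "\<dots> = ?P v \<bullet> ?Q (?P v) + ?Q (?P v) \<bullet> ?Q v"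
    by (simp only: matrix_vector_right_distrib inner_add_right
        psd_hermitian_inner[OF povm_psd[OF povm_M]])
  also have "\<dots> = ?P v \<bullet> ?Q (?P v) + ?Q v \<bullet> ?P (?Q v)"
    by (simp only: commute inner_commute)
  also have "\<dots> \<ge> 0"
    by (intro add_nonneg_nonneg psd_quadratic_form_nonneg povm_psd povm_M)
  finally have "0 \<le> ?P v \<bullet> ?Q v" .
  moreover have "(norm (?P v - ?Q v))\<^sup>2 = (norm (?P v + ?Q v))\<^sup>2 - 4 * (?P v \<bullet> ?Q v)"
    by (simp add: power2_norm_eq_inner inner_add inner_diff inner_commute)
  ultimately have "(norm (?P v - ?Q v))\<^sup>2 \<le> (norm v)\<^sup>2" by (simp add: resolution)
  then have "norm (?P v - ?Q v) \<le> norm v" by (rule power2_le_imp_le) simp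
  then show ?thesis by (simp add: povm_observable_def matrix_vector_mult_diff_rdistrib)
qed

lemma Re_ctrace_povm_mult:
  assumes "povm M"
  shows "Re (ctrace (M c ** A))
    = (Re (ctrace A) + label_sign c * Re (ctrace (povm_observable M ** A))) / 2"
proof -
  have "ctrace (M False ** A) + ctrace (M True ** A) = ctrace ((M False + M True) ** A)"
    by (simp add: ctrace_def matrix_matrix_mult_def distrib_right sum.distrib)
  also have "\<dots> = ctrace A" using assms by (simp add: povm_def)
  finally have "ctrace A = ctrace (M False ** A) + ctrace (M True ** A)" ..
  moreover have "ctrace (povm_observable M ** A) = ctrace (M True ** A) - ctrace (M False ** A)"
    by (simp add: povm_observable_def ctrace_def matrix_matrix_mult_def left_diff_distrib
        sum_subtractf)
  ultimately show ?thesis by (cases c) (simp_all add: label_sign_def)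
qed

lemma loss_eq_observable:
  assumes "density_matrix (rho \<theta> (snd z))" "povm M"
  shows "loss rho \<theta> M z
    = 1/2 - label_sign (fst z) * Re (ctrace (povm_observable M ** rho \<theta> (snd z))) / 2"
  using assms by (simp add: loss_def Re_ctrace_povm_mult density_matrix_def field_simps)

lemma loss_in_unit_interval:
  assumes density_rho: "\<And>\<theta> x. density_matrix (rho \<theta> x)" and povm_M: "povm M"
  shows "loss rho \<theta> M z \<in> {0..1}"
proof -
  have loss_le_1: "loss rho \<theta> M z \<le> 1" for z
    using density_rho[of \<theta> "snd z"] Re_ctrace_psd_mult_nonneg[OF povm_psd[OF povm_M]]
    by (simp add: loss_def density_matrix_def)
  have "loss rho \<theta> M z + loss rho \<theta> M (\<not> fst z, snd z) = 1"
    by (simp add: loss_eq_observable[OF _ povm_M] density_rho label_sign_def)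
  with loss_le_1[of z] loss_le_1[of "(\<not> fst z, snd z)"] show ?thesis by simp
qed

definition second_moment :: "'x::finite pmf \<Rightarrow> ('x \<Rightarrow> complex^'n^'n) \<Rightarrow> complex^'n^'n" where
  "second_moment q r = (\<Sum>x\<in>UNIV. pmf q x *\<^sub>R (r x ** r x))"

definition root_second_moment_trace :: "'x::finite pmf \<Rightarrow> ('x \<Rightarrow> complex^'n^'n) \<Rightarrow> real" where
  "root_second_moment_trace q r = Re (ctrace (msqrt (second_moment q r)))"

lemma second_moment_mult_vector:
  fixes r :: "'x::finite \<Rightarrow> complex^'n^'n"
  shows "second_moment q r *v v = (\<Sum>x\<in>UNIV. pmf q x *\<^sub>R (r x *v (r x *v v)))"
proof -
  have linear: "linear (\<lambda>A :: complex^'n^'n. A *v v)"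
    by (rule linearI)
      (simp_all add: vec_eq_iff matrix_vector_mult_def scaleR_sum_right sum.distrib distrib_right)
  show ?thesis
    by (simp add: second_moment_def linear_sum[OF linear] linear_scale[OF linear]
        matrix_vector_mul_assoc)
qed

lemma second_moment_quadratic_form:
  assumes "\<And>x. psd (r x)"
  shows "v \<bullet> (second_moment q r *v v) = measure_pmf.expectation q (\<lambda>x. (norm (r x *v v))\<^sup>2)"
  using assms
  by (simp add: second_moment_mult_vector inner_sum_right power2_norm_eq_inner psd_hermitian_inner
      integral_measure_pmf_real[where A = UNIV] mult.commute)

lemma psd_second_moment:
  assumes psd_r: "\<And>x. psd (r x)"
  shows "psd (second_moment q r)"
  unfolding psd_iff_psd_operator psd_operator_def selfadjoint_def
proof (intro conjI allI matrix_vector_mul_linear)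
  show "(second_moment q r *v v) \<bullet> w = v \<bullet> (second_moment q r *v w)" for v w
    by (simp add: second_moment_mult_vector inner_sum_left inner_sum_right psd_hermitian_inner
        psd_r)
  show "0 \<le> v \<bullet> (second_moment q r *v v)" for v
    by (simp add: second_moment_quadratic_form psd_r)
qed

lemma norm_density_matrix_mult_le: "density_matrix A \<Longrightarrow> norm (A *v v) \<le> 2 * norm v"
  using norm_psd_operator_le_trace[of "(*v) A" v] operator_trace_matrix[of A]
  by (simp add: density_matrix_def psd_iff_psd_operator)

lemma root_second_moment_trace_bounds:
  fixes r :: "'x::finite \<Rightarrow> complex^'n^'n"
  assumes density_r: "\<And>x. density_matrix (r x)"
  shows "root_second_moment_trace q r \<in> {0..DIM(complex^'n)}"
proof -
  have psd_r: "psd (r x)" for x using density_r by (simp add: density_matrix_def)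
  obtain E l where eigenbasis: "eigenbasis ((*v) (second_moment q r)) E l"
    and eigenvalue_nonneg: "\<And>e. e \<in> E \<Longrightarrow> 0 \<le> l e"
    by (rule psd_eigenbasis[OF psd_second_moment[of r q, OF psd_r]]) (rule that)
  then have orthonormal: "orthonormal_basis E" by (simp add: eigenbasis_def)
  have "sqrt (l e) \<le> 2" if e_in_E: "e \<in> E" for e
  proof -
    have "norm (r x *v e) \<le> 2" for x
      using norm_density_matrix_mult_le[OF density_r, of x e]
        orthonormal_basis_norm[OF orthonormal e_in_E] by simp
    then have "(norm (r x *v e))\<^sup>2 \<le> 2\<^sup>2" for x by (intro power_mono) auto
    then have "measure_pmf.expectation q (\<lambda>x. (norm (r x *v e))\<^sup>2)
      \<le> measure_pmf.expectation q (\<lambda>_. 2\<^sup>2)"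
      by (intro pmf_expectation_mono) auto
    then have "l e \<le> 2\<^sup>2"
      using eigenbasis_quadratic_form[OF eigenbasis e_in_E]
      by (simp add: second_moment_quadratic_form psd_r)
    then show ?thesis by (intro real_le_lsqrt) auto
  qed
  then have "(\<Sum>e\<in>E. sqrt (l e)) \<le> (\<Sum>e\<in>E. 2)" by (rule sum_mono)
  moreover have "0 \<le> (\<Sum>e\<in>E. sqrt (l e))" using eigenvalue_nonneg by (intro sum_nonneg) simp
  ultimately show ?thesis
    by (simp add: root_second_moment_trace_def
        Re_ctrace_msqrt[OF psd_second_moment[OF psd_r] eigenbasis]
        orthonormal_basis_card[OF orthonormal])
qed

definition signed_state_vector ::
    "('x \<Rightarrow> complex^'n^'n) \<Rightarrow> complex^'n \<Rightarrow> (bool \<times> 'x) \<times> real \<Rightarrow> complex^'n" where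
  "signed_state_vector r e y = (snd y * label_sign (fst (fst y))) *\<^sub>R (r (snd (fst y)) *v e)"

lemma signed_loss_sum_le:
  assumes density_rho: "\<And>x. density_matrix (rho \<theta> x)" and povm_M: "povm M"
    and orthonormal: "orthonormal_basis E"
  shows "(\<Sum>j<N. snd (S j) * loss rho \<theta> M (fst (S j)))
    \<le> (\<Sum>j<N. snd (S j)) / 2 + (\<Sum>e\<in>E. norm (\<Sum>j<N. signed_state_vector (rho \<theta>) e (S j))) / 4"
proof -
  let ?K = "(*v) (povm_observable M)" and ?X = "signed_state_vector (rho \<theta>)"
  have "snd y * loss rho \<theta> M (fst y) = snd y / 2 - (\<Sum>e\<in>E. ?K e \<bullet> ?X e y) / 4" for y
    by (simp add: loss_eq_observable[where rho = rho, OF density_rho povm_M] signed_state_vector_def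
        Re_ctrace_mult_orthonormal_basis[OF orthonormal hermitian_povm_observable[OF povm_M]]
        right_diff_distrib flip: sum_distrib_left)
  then have "(\<Sum>j<N. snd (S j) * loss rho \<theta> M (fst (S j)))
      = (\<Sum>j<N. snd (S j)) / 2 - (\<Sum>j<N. \<Sum>e\<in>E. ?K e \<bullet> ?X e (S j)) / 4"
    by (simp add: sum_subtractf sum_divide_distrib)
  also have "(\<Sum>j<N. \<Sum>e\<in>E. ?K e \<bullet> ?X e (S j)) = (\<Sum>e\<in>E. ?K e \<bullet> (\<Sum>j<N. ?X e (S j)))"
    unfolding inner_sum_right by (rule sum.swap)
  finally have signed_loss: "(\<Sum>j<N. snd (S j) * loss rho \<theta> M (fst (S j)))
      = (\<Sum>j<N. snd (S j)) / 2 - (\<Sum>e\<in>E. ?K e \<bullet> (\<Sum>j<N. ?X e (S j))) / 4" .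
  have "(\<Sum>e\<in>E. - (?K e \<bullet> (\<Sum>j<N. ?X e (S j)))) \<le> (\<Sum>e\<in>E. norm (\<Sum>j<N. ?X e (S j)))"
  proof (rule sum_mono)
    fix e assume "e \<in> E"
    then have "norm (?K e) \<le> 1"
      using norm_povm_observable_mult_le[OF povm_M, of e] orthonormal_basis_norm[OF orthonormal]
      by simp
    then have "norm (?K e) * norm (\<Sum>j<N. ?X e (S j)) \<le> 1 * norm (\<Sum>j<N. ?X e (S j))"
      by (intro mult_right_mono) auto
    then show "- (?K e \<bullet> (\<Sum>j<N. ?X e (S j))) \<le> norm (\<Sum>j<N. ?X e (S j))"
      using Cauchy_Schwarz_ineq2[of "?K e" "\<Sum>j<N. ?X e (S j)"] by linarith
  qed
  then show ?thesis unfolding signed_loss sum_negf by linarith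
qed

lemma expectation_norm_signed_state_sum_le:
  fixes p :: "(bool \<times> 'x::finite) pmf" and r :: "'x \<Rightarrow> complex^'n^'n"
  assumes psd_r: "\<And>x. psd (r x)"
  shows "measure_pmf.expectation (sample_pmf N (pair_pmf p rademacher))
      (\<lambda>S. norm (\<Sum>j<N. signed_state_vector r e (S j)))
    \<le> sqrt (real N * (e \<bullet> (second_moment (map_pmf snd p) r *v e)))"
proof -
  let ?q = "pair_pmf p rademacher" and ?X = "signed_state_vector r e"
  have finite_q: "finite (set_pmf ?q)" by (rule finite_set_pair_rademacher) simp
  have "measure_pmf.expectation ?q ?X \<bullet> w = 0" for w
    by (simp add: expectation_pair_rademacher signed_state_vector_def
        flip: integral_inner_left[OF integrable_measure_pmf_finite[OF finite_q]])
  then have "measure_pmf.expectation ?q ?X = 0" by (metis inner_eq_zero_iff)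
  moreover have "measure_pmf.expectation ?q (\<lambda>y. (norm (?X y))\<^sup>2)
      = e \<bullet> (second_moment (map_pmf snd p) r *v e)"
    by (simp add: expectation_pair_rademacher signed_state_vector_def second_moment_quadratic_form
        psd_r abs_label_sign abs_mult)
  ultimately show ?thesis
    using expectation_norm_sum_le[of "{..<N}" "\<lambda>_. ?q" "\<lambda>_. ?X" undefined] finite_q
    by (simp add: sample_pmf_def)
qed

lemma rademacher_complexity_povm_le:
  fixes p :: "(bool \<times> 'x::finite) pmf" and rho :: "'t \<Rightarrow> 'x \<Rightarrow> complex^'n^'n"
  assumes density_rho: "\<And>x. density_matrix (rho \<theta> x)" and N_pos: "N > 0"
  shows "rademacher_complexity N p {M. povm M} (loss rho \<theta>)
    \<le> root_second_moment_trace (map_pmf snd p) (rho \<theta>) / 2"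
proof -
  let ?A = "second_moment (map_pmf snd p) (rho \<theta>)" and ?X = "signed_state_vector (rho \<theta>)"
  let ?q = "pair_pmf p rademacher" and ?R = "sqrt (real N)"
  let ?E = "measure_pmf.expectation (sample_pmf N ?q)"
  have psd_rho: "psd (rho \<theta> x)" for x using density_rho by (simp add: density_matrix_def)
  obtain E l where eigenbasis: "eigenbasis ((*v) ?A) E l"
    by (rule psd_eigenbasis[OF psd_second_moment[of "rho \<theta>" "map_pmf snd p", OF psd_rho]])
      (rule that)
  then have orthonormal: "orthonormal_basis E" by (simp add: eigenbasis_def)
  have finite_q: "finite (set_pmf ?q)" by (rule finite_set_pair_rademacher) simp
  then have finite_S: "finite (set_pmf (sample_pmf N ?q))" by (rule finite_set_sample_pmf)
  have "rademacher_complexity N p {M. povm M} (loss rho \<theta>)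
    \<le> ?E (\<lambda>S. ((\<Sum>j<N. snd (S j)) / 2 + (\<Sum>e\<in>E. norm (\<Sum>j<N. ?X e (S j))) / 4) / ?R)"
    unfolding rademacher_complexity_def signed_sup_def
    by (intro pmf_expectation_mono finite_S cSUP_least povm_exists divide_right_mono
        signed_loss_sum_le density_rho orthonormal) auto
  also have "\<dots> = (?E (\<lambda>S. \<Sum>j<N. snd (S j)) / 2 + (\<Sum>e\<in>E. ?E (\<lambda>S. norm (\<Sum>j<N. ?X e (S j)))) / 4) / ?R"
    by (simp add: integrable_measure_pmf_finite[OF finite_S])
  also have "?E (\<lambda>S. \<Sum>j<N. snd (S j)) = 0"
    using expectation_sample_pmf_sum[OF finite_q, of N snd]
    by (simp add: expectation_pair_rademacher)
  also have "(\<Sum>e\<in>E. ?E (\<lambda>S. norm (\<Sum>j<N. ?X e (S j)))) \<le> (\<Sum>e\<in>E. ?R * sqrt (l e))"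
  proof (rule sum_mono)
    fix e assume "e \<in> E"
    then show "?E (\<lambda>S. norm (\<Sum>j<N. ?X e (S j))) \<le> ?R * sqrt (l e)"
      using expectation_norm_signed_state_sum_le[of "rho \<theta>" N p e, OF psd_rho]
        eigenbasis_quadratic_form[OF eigenbasis]
      by (simp add: real_sqrt_mult)
  qed
  finally show ?thesis
    using N_pos Re_ctrace_msqrt[OF psd_second_moment[OF psd_rho] eigenbasis]
    by (simp add: root_second_moment_trace_def divide_right_mono flip: sum_distrib_left)
qed

lemma rad_M_eq_rademacher_complexity:
  "rad_M N p rho = (SUP \<theta>. rademacher_complexity N p {M. povm M} (loss rho \<theta>))"
  by (simp add: rad_M_def rademacher_complexity_def signed_sup_def)

lemma rad_TM_eq_rademacher_complexity:
  "rad_TM N p rho = rademacher_complexity N p (UNIV \<times> {M. povm M}) (\<lambda>(\<theta>, M). loss rho \<theta> M)"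
  by (simp add: rad_TM_def rademacher_complexity_def signed_sup_def case_prod_unfold)

text \<open>At \<open>t = 0\<close> the middle term is 1, because \<open>log 2 0 = 0\<close>.\<close>

lemma powr_two_log_bounds:
  fixes t :: real
  assumes "t \<in> {0..C}"
  shows "t\<^sup>2 \<le> 2 powr (2 * log 2 t) \<and> 2 powr (2 * log 2 t) \<le> max 1 (C\<^sup>2)"
proof -
  have "2 powr (2 * log 2 t) = (if t = 0 then 1 else t\<^sup>2)"
  proof (cases "t = 0")
    case False
    then have "2 powr (2 * log 2 t) = 2 powr log 2 (t\<^sup>2)" using assms by (simp add: log_nat_power)
    then show ?thesis using False by simp
  qed (simp add: log_def)
  moreover have "t\<^sup>2 \<le> C\<^sup>2" using assms by (intro power_mono) auto
  ultimately show ?thesis by auto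
qed

lemma root_second_moment_trace_le_renyi:
  fixes p :: "(bool \<times> 'x::finite) pmf" and rho :: "'t \<Rightarrow> 'x \<Rightarrow> complex^'n^'n"
  assumes density_rho: "\<And>\<theta> x. density_matrix (rho \<theta> x)"
  shows "root_second_moment_trace (map_pmf snd p) (rho \<theta>) \<le> sqrt (SUP \<theta>. 2 powr renyi2_MI p rho \<theta>)"
proof (rule real_le_rsqrt)
  let ?t = "\<lambda>\<theta>. root_second_moment_trace (map_pmf snd p) (rho \<theta>)"
  have renyi: "renyi2_MI p rho \<theta> = 2 * log 2 (?t \<theta>)" for \<theta>
    by (simp add: renyi2_MI_def root_second_moment_trace_def second_moment_def)
  have bounds: "(?t \<theta>)\<^sup>2 \<le> 2 powr renyi2_MI p rho \<theta>"
    "2 powr renyi2_MI p rho \<theta> \<le> max 1 ((real DIM(complex^'n))\<^sup>2)" for \<theta>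
    unfolding renyi
    using powr_two_log_bounds[OF root_second_moment_trace_bounds[of "rho \<theta>", OF density_rho]]
    by blast+
  have "bdd_above (range (\<lambda>\<theta>. 2 powr renyi2_MI p rho \<theta>))"
    using bounds(2) by (intro bdd_aboveI2)
  then show "(?t \<theta>)\<^sup>2 \<le> (SUP \<theta>. 2 powr renyi2_MI p rho \<theta>)"
    using bounds(1)[of \<theta>] by (rule cSUP_upper2[where x = \<theta>, OF _ UNIV_I])
qed

lemma rademacher_complexity_povm_le_renyi:
  fixes p :: "(bool \<times> 'x::finite) pmf" and rho :: "'t \<Rightarrow> 'x \<Rightarrow> complex^'n^'n"
  assumes density_rho: "\<And>\<theta> x. density_matrix (rho \<theta> x)" and N_pos: "N > 0"
  shows "rademacher_complexity N p {M. povm M} (loss rho \<theta>)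
    \<le> 1/2 * sqrt (SUP \<theta>. 2 powr renyi2_MI p rho \<theta>)"
  using rademacher_complexity_povm_le[of rho \<theta>, OF density_rho N_pos, of p]
    root_second_moment_trace_le_renyi[of rho p \<theta>, OF density_rho] by simp

lemma rad_M_le_renyi:
  fixes p :: "(bool \<times> 'x::finite) pmf"
  assumes "\<And>\<theta> x. density_matrix (rho \<theta> x)" "N > 0"
  shows "rad_M N p rho \<le> 1/2 * sqrt (SUP \<theta>. 2 powr renyi2_MI p rho \<theta>)"
  unfolding rad_M_eq_rademacher_complexity
  by (intro cSUP_least rademacher_complexity_povm_le_renyi assms) simp

lemma rad_M_nonneg:
  fixes p :: "(bool \<times> 'x::finite) pmf" and rho :: "'t \<Rightarrow> 'x \<Rightarrow> complex^'n^'n"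
  assumes density_rho: "\<And>\<theta> x. density_matrix (rho \<theta> x)" and N_pos: "N > 0"
  shows "0 \<le> rad_M N p rho"
  unfolding rad_M_eq_rademacher_complexity
proof (rule cSUP_upper2[OF _ UNIV_I])
  show "bdd_above (range (\<lambda>\<theta>. rademacher_complexity N p {M. povm M} (loss rho \<theta>)))"
    using rademacher_complexity_povm_le_renyi[of rho, OF density_rho N_pos] by (intro bdd_aboveI2)
  have "\<bar>loss rho \<theta> M z\<bar> \<le> 1" if "M \<in> {M. povm M}" for \<theta> M z
    using loss_in_unit_interval[of rho M \<theta> z, OF density_rho] that by simp
  then show "0 \<le> rademacher_complexity N p {M. povm M} (loss rho (undefined :: 't))"
    by (intro rademacher_complexity_nonneg povm_exists) simp_all
qed

lemma empirical_minimizer_exp_risk_le: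
  fixes p :: "(bool \<times> 'x::finite) pmf" and rho :: "'t \<Rightarrow> 'x \<Rightarrow> complex^'n^'n"
  assumes density_rho: "\<And>\<theta> x. density_matrix (rho \<theta> x)" and N_pos: "N > 0"
    and delta: "0 < \<delta>" "\<delta> < 1"
    and povm_Mhat: "\<And>D. povm (Mhat D)"
    and minimal: "\<And>D \<theta> M. povm M \<Longrightarrow> emp_risk N rho (thetahat D) (Mhat D) D \<le> emp_risk N rho \<theta> M D"
  shows "1 - \<delta> \<le> measure_pmf.prob (sample_pmf N p)
    {D. \<forall>\<theta> M. povm M \<longrightarrow> exp_risk p rho (thetahat D) (Mhat D)
      \<le> exp_risk p rho \<theta> M + 2 * rad_TM N p rho / sqrt (real N) + sqrt (2 / real N * ln (1 / \<delta>))}"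
proof -
  let ?g = "\<lambda>(\<theta>, M). loss rho \<theta> M" and ?I = "UNIV \<times> {M. povm M}"
  have loss_unit: "?g i z \<in> {0..1}" if "i \<in> ?I" for i z
    using that
    by (cases i) (simp add: loss_in_unit_interval[of rho, OF density_rho] del: atLeastAtMost_iff)
  have "emp_mean N (?g (thetahat D, Mhat D)) D \<le> emp_mean N (?g i) D" if "i \<in> ?I" for D i
    using that minimal by (auto simp: emp_risk_def emp_mean_def)
  from empirical_risk_minimizer_excess_risk[where g = ?g and I = ?I and p = p,
      OF _ N_pos delta loss_unit _ this]
  show ?thesis
    using povm_Mhat by (simp add: exp_risk_def rad_TM_eq_rademacher_complexity)
qed

theorem theorem4p2:
  fixes p :: "(bool \<times> 'x::finite) pmf"
    and rho :: "'t \<Rightarrow> 'x \<Rightarrow> complex^'n^'n"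
    and N :: nat and \<delta> :: real
    and thetahat :: "(nat \<Rightarrow> bool \<times> 'x) \<Rightarrow> 't"
    and Mhat :: "'t \<Rightarrow> (nat \<Rightarrow> bool \<times> 'x) \<Rightarrow> bool \<Rightarrow> complex^'n^'n"
  assumes dens: "\<And>\<theta> x. density_matrix (rho \<theta> x)"
    and N_pos: "N > 0"
    and delta: "0 < \<delta>" "\<delta> < 1"
    and Mhat_povm: "\<And>\<theta> D. povm (Mhat \<theta> D)"
    and Mhat_min: "\<And>\<theta> D M. povm M \<Longrightarrow> emp_risk N rho \<theta> (Mhat \<theta> D) D \<le> emp_risk N rho \<theta> M D"
    and thetahat_min: "\<And>D \<theta>. emp_risk N rho (thetahat D) (Mhat (thetahat D) D) D
                                \<le> emp_risk N rho \<theta> (Mhat \<theta> D) D"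
  shows "measure_pmf.prob (sample_pmf N p)
           {D. exp_risk p rho (thetahat D) (Mhat (thetahat D) D) - opt_risk p rho (thetahat D)
               \<le> 2 * (rad_TM N p rho + rad_M N p rho) / sqrt (real N)
                 + sqrt (2 / real N * ln (2 / \<delta>))} \<ge> 1 - \<delta>
         \<and> rad_M N p rho \<le> 1/2 * sqrt (SUP \<theta>. 2 powr renyi2_MI p rho \<theta>)"
    (is "measure_pmf.prob ?S ?good \<ge> _ \<and> ?renyi_bound")
proof
  let ?\<epsilon> = "2 * rad_TM N p rho / sqrt (real N) + sqrt (2 / real N * ln (2 / \<delta>))"
  let ?risk = "\<lambda>D. exp_risk p rho (thetahat D) (Mhat (thetahat D) D)"
  let ?close = "{D. \<forall>\<theta> M. povm M \<longrightarrow> ?risk D \<le> exp_risk p rho \<theta> M + ?\<epsilon>}"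
  have "emp_risk N rho (thetahat D) (Mhat (thetahat D) D) D \<le> emp_risk N rho \<theta> M D" if "povm M"
    for D \<theta> M
    using thetahat_min[of D \<theta>] Mhat_min[OF that, of \<theta> D] by (rule order_trans)
  then have "1 - \<delta> / 2 \<le> measure_pmf.prob ?S ?close"
    using empirical_minimizer_exp_risk_le[where rho = rho and p = p and \<delta> = "\<delta> / 2"
        and thetahat = thetahat and Mhat = "\<lambda>D. Mhat (thetahat D) D",
        OF dens N_pos _ _ Mhat_povm] delta
    by (simp add: add.assoc)
  also have "\<dots> \<le> measure_pmf.prob ?S ?good"
  proof (intro measure_pmf.finite_measure_mono subsetI CollectI)
    fix D assume "D \<in> ?close"
    then have "?risk D - ?\<epsilon> \<le> opt_risk p rho (thetahat D)"
      unfolding opt_risk_def by (intro cINF_greatest povm_exists) (simp add: diff_le_eq)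
    moreover have "0 \<le> 2 * rad_M N p rho / sqrt (real N)"
      using rad_M_nonneg[of rho, OF dens N_pos] by simp
    ultimately show "?risk D - opt_risk p rho (thetahat D)
        \<le> 2 * (rad_TM N p rho + rad_M N p rho) / sqrt (real N) + sqrt (2 / real N * ln (2 / \<delta>))"
      by (simp add: distrib_left add_divide_distrib)
  qed simp
  finally show "1 - \<delta> \<le> measure_pmf.prob ?S ?good" using delta by simp
  show ?renyi_bound using dens N_pos by (rule rad_M_le_renyi)
qed

end
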